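(* Let $\hat\varphi:\Lambda\mathsf{Lie}_\infty\to\mathcal O$ be a map of dg operads, let $V$ be an $\mathcal O$-algebra equipped with a complete descending filtration $V=\mathcal F_0V\supset\mathcal F_1V\supset\mathcal F_2V\supset\cdots$ compatible with the $\mathcal O$-algebra structure, and let $\alpha\in\mathcal F_1V$ be a Maurer–Cartan element. Let $V^\alpha$ be the cochain complex obtained from $V$ by twisting the differential by $\alpha$, i.e. $V$ with the differential $\partial^\alpha(v)=\partial(v)+\sum_{r\ge1}\frac1{r!}\varphi_{r+1}(\alpha,\dots,\alpha,v)$. Then the formula $$f(v_1,\dots,v_n)=\sum_{r=0}^\infty\frac1{r!}f_r(\alpha,\dots,\alpha,v_1,\dots,v_n),\qquad f=(f_r)_{r\ge0}\in\mathrm{Tw}\,\mathcal O(n),\ v_i\in V,$$ defines a $\mathrm{Tw}\,\mathcal O$-algebra structure on $V^\alpha$.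
   Context: **Conventions.** $\mathbb K$ is a field of characteristic zero. A dg operad is a unital symmetric operad in unbounded cochain complexes over $\mathbb K$ (differentials of degree $+1$), with elementary insertions $\circ_i$. $\mathbf s$ raises degree by one. $\mathrm{Sh}_{p,q}\subset S_{p+q}$ is the set of $\sigma$ with $\sigma(1)<\dots<\sigma(p)$ and $\sigma(p+1)<\dots<\sigma(p+q)$. For $v\in\mathcal O(k)$, $w\in\mathcal O(m)$, an expression $v(i_1,\dots,w(j_1,\dots,j_m),\dots)$ in which each of $1,\dots,k+m-1$ occurs once denotes the operadic composite with inputs labelled as displayed. **$\Lambda\mathsf{Lie}_\infty$** is the dg operad free as a graded operad on $S_n$-invariant generators $\lambda_n$, arity $n\ge2$, degree $3-2n$, with $\partial\lambda_n=-\sum_{p=2}^{n-1}\sum_{\sigma\in\mathrm{Sh}_{p,n-p}}\sigma(\lambda_{n-p+1}\circ_1\lambda_p)$. **$\mathrm{Tw}\,\mathcal O$.** Put $\varphi_n=\hat\varphi(\lambda_n)$ for $n\ge2$, $\varphi_1=0$. $\mathrm{Tw}\,\mathcal O(n)=\prod_{r\ge0}\mathbf s^{2r}(\mathcal O(r+n))^{S_r}$, where $S_r\subset S_{r+n}$ permutes the first $r$ letters: a homogeneous $f$ is a sequence $(f_r)_{r\ge0}$ with $f_r\in\mathcal O(r+n)^{S_r}$ of degree $|f|-2r$. $S_n$ acts on the last $n$ inputs; the unit is $(u_{\mathcal O},0,0,\dots)$; for $f\in\mathrm{Tw}\,\mathcal O(n)$, $g\in\mathrm{Tw}\,\mathcal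 O(m)$, $$(f\circ_ig)_r=\sum_{p=0}^r\sum_{\sigma\in\mathrm{Sh}_{p,r-p}}f_p(\sigma(1),\dots,\sigma(p),r+1,\dots,r+i-1,g_{r-p}(\sigma(p+1),\dots,\sigma(r),r+i,\dots,r+i+m-1),r+i+m,\dots,r+n+m-1).$$ With $\kappa\in\mathrm{Tw}\,\mathcal O(1)$, $\kappa_r=\varphi_{r+1}$, the differential is $$(\partial^{\mathrm{Tw}}f)_r=\partial^{\mathcal O}f_r-(-1)^{|f|}\sum_{p=1}^r\sum_{\sigma\in\mathrm{Sh}_{p,r-p}}f_{r-p+1}(\varphi_p(\sigma(1),\dots,\sigma(p)),\sigma(p+1),\dots,\sigma(r),r+1,\dots,r+n)+(\kappa\circ_1f)_r-(-1)^{|f|}\sum_{i=1}^n(f\circ_i\kappa)_r.$$ **Filtrations and Maurer–Cartan elements.** Complete means $V=\lim_kV/\mathcal F_kV$. Compatible with the $\mathcal O$-algebra structure means that the differential preserves the filtration and every operation maps $\mathcal F_{i_1}V\otimes\dots\otimes\mathcal F_{i_n}V$ into $\mathcal F_{i_1+\dots+i_n}V$. A Maurer–Cartan element is a degree $2$ element $\alpha\in\mathcal F_1V$ with $\partial\alpha+\sum_{n\ge2}\frac1{n!}\varphi_n(\alpha,\dots,\alpha)=0$. *)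

theory Defs
  imports
    "HOL-Combinatorics.Permutations"
    "HOL-Computational_Algebra.Polynomial"
    "HOL-Library.Function_Algebras"
    "HOL-Library.Product_Plus"
begin

section \<open>Graded vector spaces\<close>

text \<open>A graded vector space is a family of subspaces (the homogeneous components) of an ambient
  vector space. Distinct components meet trivially, so a nonzero homogeneous element determines its
  degree. Only homogeneous elements are ever used, and maps are only constrained on them.\<close>

definition graded_space :: "('k::field \<Rightarrow> 'a::ab_group_add \<Rightarrow> 'a) \<Rightarrow> (int \<Rightarrow> 'a set) \<Rightarrow> bool" where
  "graded_space s A \<longleftrightarrow> vector_space s \<and> (\<forall>d. module.subspace s (A d)) \<and>
     (\<forall>d e. d \<noteq> e \<longrightarrow> A d \<inter> A e = {0})"

definition linear_on ::
    "('k \<Rightarrow> 'a::ab_group_add \<Rightarrow> 'a) \<Rightarrow> ('k \<Rightarrow> 'b::ab_group_add \<Rightarrow> 'b) \<Rightarrow> 'a set \<Rightarrow> ('a \<Rightarrow> 'b) \<Rightarrow> bool" where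
  "linear_on s t A h \<longleftrightarrow> (\<forall>x\<in>A. \<forall>y\<in>A. h (x + y) = h x + h y) \<and> (\<forall>c. \<forall>x\<in>A. h (s c x) = t c (h x))"


section \<open>Operads\<close>

text \<open>\<open>component P n d\<close> is the degree \<open>d\<close> component in arity \<open>n\<close>; \<open>act P n \<sigma> f\<close> is the left action of a
  permutation of \<open>{1..n}\<close>; \<open>ins P n i m f g\<close> is the insertion of \<open>g\<close> (arity \<open>m\<close>) into the \<open>i\<close>-th input
  of \<open>f\<close> (arity \<open>n\<close>), with inputs counted from 1. The operations carry their arities, and the
  differential also the degree of its argument, because in twisted operads they depend on them.\<close>

record ('k, 'a) operad_struct =
  oscale :: "'k \<Rightarrow> 'a \<Rightarrow> 'a"
  component :: "nat \<Rightarrow> int \<Rightarrow> 'a set"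
  act :: "nat \<Rightarrow> (nat \<Rightarrow> nat) \<Rightarrow> 'a \<Rightarrow> 'a"
  unit :: 'a
  ins :: "nat \<Rightarrow> nat \<Rightarrow> nat \<Rightarrow> 'a \<Rightarrow> 'a \<Rightarrow> 'a"

record ('k, 'a) dg_operad_struct = "('k, 'a) operad_struct" +
  odiff :: "nat \<Rightarrow> int \<Rightarrow> 'a \<Rightarrow> 'a"

text \<open>\<open>\<sigma>\<close> acts by relabelling: in \<open>\<sigma> f\<close> the \<open>j\<close>-th input of \<open>f\<close> is labelled \<open>\<sigma> j\<close>, that is,
  \<open>\<sigma> f = f(\<sigma>(1),\<dots>,\<sigma>(n))\<close>. The permutation below is therefore the one for which
  \<open>(\<sigma> f) \<circ>\<^bsub>\<sigma> i\<^esub> (\<tau> g) = (ins_perm n i m \<sigma> \<tau>) (f \<circ>\<^sub>i g)\<close>.\<close>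

definition ins_perm :: "nat \<Rightarrow> nat \<Rightarrow> nat \<Rightarrow> (nat \<Rightarrow> nat) \<Rightarrow> (nat \<Rightarrow> nat) \<Rightarrow> nat \<Rightarrow> nat" where
  "ins_perm n i m \<sigma> \<tau> = (\<lambda>j.
     let outer = (\<lambda>k. if \<sigma> k < \<sigma> i then \<sigma> k else \<sigma> k + m - 1) in
     if j \<notin> {1..n + m - 1} then j
     else if j < i then outer j
     else if j < i + m then \<sigma> i - 1 + \<tau> (j - i + 1)
     else outer (j + 1 - m))"

locale graded_operad =
  fixes P :: "('k::field, 'a::ab_group_add, 'z) operad_struct_scheme"
  assumes graded: "graded_space (oscale P) (component P n)"
    and act_closed: "\<lbrakk>\<sigma> permutes {1..n}; f \<in> component P n d\<rbrakk> \<Longrightarrow> act P n \<sigma> f \<in> component P n d"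
    and act_linear: "\<sigma> permutes {1..n} \<Longrightarrow> linear_on (oscale P) (oscale P) (component P n d) (act P n \<sigma>)"
    and act_id: "f \<in> component P n d \<Longrightarrow> act P n id f = f"
    and act_act: "\<lbrakk>\<sigma> permutes {1..n}; \<tau> permutes {1..n}; f \<in> component P n d\<rbrakk>
          \<Longrightarrow> act P n (\<tau> \<circ> \<sigma>) f = act P n \<tau> (act P n \<sigma> f)"
    and unit_closed: "unit P \<in> component P 1 0"
    and ins_closed: "\<lbrakk>i \<in> {1..n}; f \<in> component P n d; g \<in> component P m e\<rbrakk>
          \<Longrightarrow> ins P n i m f g \<in> component P (n + m - 1) (d + e)"
    and ins_linear_left: "\<lbrakk>i \<in> {1..n}; g \<in> component P m e\<rbrakk>
          \<Longrightarrow> linear_on (oscale P) (oscale P) (component P n d) (\<lambda>f. ins P n i m f g)"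
    and ins_linear_right: "\<lbrakk>i \<in> {1..n}; f \<in> component P n d\<rbrakk>
          \<Longrightarrow> linear_on (oscale P) (oscale P) (component P m e) (\<lambda>g. ins P n i m f g)"
    and ins_unit_right: "\<lbrakk>i \<in> {1..n}; f \<in> component P n d\<rbrakk> \<Longrightarrow> ins P n i 1 f (unit P) = f"
    and ins_unit_left: "g \<in> component P m e \<Longrightarrow> ins P 1 1 m (unit P) g = g"
    and ins_sequential:
          "\<lbrakk>i \<in> {1..n}; j \<in> {1..m}; f \<in> component P n d; g \<in> component P m e; h \<in> component P l c\<rbrakk>
          \<Longrightarrow> ins P (n + m - 1) (i + j - 1) l (ins P n i m f g) h
            = ins P n i (m + l - 1) f (ins P m j l g h)"
    and ins_parallel:
          "\<lbrakk>1 \<le> i; i < j; j \<le> n; f \<in> component P n d; g \<in> component P m e; h \<in> component P l c\<rbrakk>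
          \<Longrightarrow> ins P (n + m - 1) (j + m - 1) l (ins P n i m f g) h
            = oscale P ((-1) powi (e * c)) (ins P (n + l - 1) i m (ins P n j l f h) g)"
    and ins_equivariant:
          "\<lbrakk>i \<in> {1..n}; \<sigma> permutes {1..n}; \<tau> permutes {1..m}; f \<in> component P n d; g \<in> component P m e\<rbrakk>
          \<Longrightarrow> ins P n (\<sigma> i) m (act P n \<sigma> f) (act P m \<tau> g)
            = act P (n + m - 1) (ins_perm n i m \<sigma> \<tau>) (ins P n i m f g)"

locale dg_operad = graded_operad P
  for P :: "('k::field, 'a::ab_group_add, 'z) dg_operad_struct_scheme" +
  assumes odiff_closed: "f \<in> component P n d \<Longrightarrow> odiff P n d f \<in> component P n (d + 1)"
    and odiff_linear: "linear_on (oscale P) (oscale P) (component P n d) (odiff P n d)"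
    and odiff_odiff: "f \<in> component P n d \<Longrightarrow> odiff P n (d + 1) (odiff P n d f) = 0"
    and odiff_act: "\<lbrakk>\<sigma> permutes {1..n}; f \<in> component P n d\<rbrakk>
          \<Longrightarrow> odiff P n d (act P n \<sigma> f) = act P n \<sigma> (odiff P n d f)"
    and odiff_unit: "odiff P 1 0 (unit P) = 0"
    and odiff_ins: "\<lbrakk>i \<in> {1..n}; f \<in> component P n d; g \<in> component P m e\<rbrakk>
          \<Longrightarrow> odiff P (n + m - 1) (d + e) (ins P n i m f g)
            = ins P n i m (odiff P n d f) g
              + oscale P ((-1) powi d) (ins P n i m f (odiff P m e g))"

definition operad_morphism ::
    "('k, 'a::ab_group_add, 'y) operad_struct_scheme \<Rightarrow> ('k, 'b::ab_group_add, 'z) operad_struct_scheme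
      \<Rightarrow> (nat \<Rightarrow> 'a \<Rightarrow> 'b) \<Rightarrow> bool" where
  "operad_morphism P Q \<Phi> \<longleftrightarrow>
     (\<forall>n d. \<Phi> n ` component P n d \<subseteq> component Q n d \<and> linear_on (oscale P) (oscale Q) (component P n d) (\<Phi> n)) \<and>
     (\<forall>n d \<sigma>. \<forall>f\<in>component P n d. \<sigma> permutes {1..n} \<longrightarrow> \<Phi> n (act P n \<sigma> f) = act Q n \<sigma> (\<Phi> n f)) \<and>
     \<Phi> 1 (unit P) = unit Q \<and>
     (\<forall>n m d e i. \<forall>f\<in>component P n d. \<forall>g\<in>component P m e. i \<in> {1..n} \<longrightarrow>
        \<Phi> (n + m - 1) (ins P n i m f g) = ins Q n i m (\<Phi> n f) (\<Phi> m g))"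

definition dg_operad_morphism ::
    "('k, 'a::ab_group_add, 'y) dg_operad_struct_scheme
      \<Rightarrow> ('k, 'b::ab_group_add, 'z) dg_operad_struct_scheme \<Rightarrow> (nat \<Rightarrow> 'a \<Rightarrow> 'b) \<Rightarrow> bool" where
  "dg_operad_morphism P Q \<Phi> \<longleftrightarrow> operad_morphism P Q \<Phi> \<and>
     (\<forall>n d. \<forall>f\<in>component P n d. \<Phi> n (odiff P n d f) = odiff Q n d (\<Phi> n f))"

definition Sh :: "nat \<Rightarrow> nat \<Rightarrow> (nat \<Rightarrow> nat) set" where
  "Sh p q = {\<sigma>. \<sigma> permutes {1..p + q} \<and> strict_mono_on {1..p} \<sigma> \<and> strict_mono_on {p + 1..p + q} \<sigma>}"

text \<open>\<open>labelled_ins P v is w js ks\<close> is the composite \<open>v(is, w(js), ks)\<close> whose inputs are labelled as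
  displayed by the entries of the lists; the arities of \<open>v\<close> and \<open>w\<close> are read off from the lengths.\<close>

definition list_perm :: "nat list \<Rightarrow> nat \<Rightarrow> nat" where
  "list_perm ls = (\<lambda>j. if j \<in> {1..length ls} then ls ! (j - 1) else j)"

definition labelled_ins ::
    "('k, 'a, 'z) operad_struct_scheme \<Rightarrow> 'a \<Rightarrow> nat list \<Rightarrow> 'a \<Rightarrow> nat list \<Rightarrow> nat list \<Rightarrow> 'a" where
  "labelled_ins P v is w js ks =
     act P (length is + length js + length ks) (list_perm (is @ js @ ks))
       (ins P (length is + 1 + length ks) (length is + 1) (length js) v w)"


section \<open>The operad \<open>\<Lambda>Lie\<^sub>\<infinity>\<close>\<close>

definition invariant_family ::
    "nat set \<Rightarrow> (nat \<Rightarrow> int) \<Rightarrow> ('k, 'a, 'z) operad_struct_scheme \<Rightarrow> (nat \<Rightarrow> 'a) \<Rightarrow> bool" where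
  "invariant_family N \<delta> P x \<longleftrightarrow>
     (\<forall>n\<in>N. x n \<in> component P n (\<delta> n) \<and> (\<forall>\<sigma>. \<sigma> permutes {1..n} \<longrightarrow> act P n \<sigma> (x n) = x n))"

text \<open>\<open>P\<close> is free as a graded operad on invariant generators \<open>x n\<close> of arity \<open>n \<in> N\<close> and degree \<open>\<delta> n\<close>,
  expressed by the universal property. The operads \<open>Q\<close> it is tested against live on the type
  \<open>'k poly \<times> 'a\<close>, since a definition cannot quantify over types. Nothing is lost by this: each arity
  of the free operad has countable dimension over \<open>'k\<close>, so \<open>'k poly \<times> 'a\<close> has room for a copy of the
  free operad as well as for a copy of \<open>P\<close> itself, and the property for these two already makes
  \<open>P\<close> isomorphic to the free operad.\<close>

definition free_graded_operad ::
    "nat set \<Rightarrow> (nat \<Rightarrow> int) \<Rightarrow> ('k::field, 'a::ab_group_add, 'z) operad_struct_scheme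
      \<Rightarrow> (nat \<Rightarrow> 'a) \<Rightarrow> bool" where
  "free_graded_operad N \<delta> P x \<longleftrightarrow>
     graded_operad P \<and> invariant_family N \<delta> P x \<and>
     (\<forall>(Q :: ('k, 'k poly \<times> 'a) operad_struct) y.
        graded_operad Q \<and> invariant_family N \<delta> Q y \<longrightarrow>
        (\<exists>\<Phi>. operad_morphism P Q \<Phi> \<and> (\<forall>n\<in>N. \<Phi> n (x n) = y n) \<and>
          (\<forall>\<Psi>. operad_morphism P Q \<Psi> \<and> (\<forall>n\<in>N. \<Psi> n (x n) = y n) \<longrightarrow>
             (\<forall>n d. \<forall>f\<in>component P n d. \<Psi> n f = \<Phi> n f))))"

locale Lambda_Lie_infinity = dg_operad L
  for L :: "('k::field, 'l::ab_group_add, 'z) dg_operad_struct_scheme" +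
  fixes lam :: "nat \<Rightarrow> 'l"
  assumes free: "free_graded_operad {2..} (\<lambda>n. 3 - 2 * int n) L lam"
    and odiff_lam: "n \<ge> 2 \<Longrightarrow> odiff L n (3 - 2 * int n) (lam n) =
          - (\<Sum>p = 2..n - 1. \<Sum>\<sigma>\<in>Sh p (n - p).
               act L n \<sigma> (ins L (n - p + 1) 1 p (lam (n - p + 1)) (lam p)))"

definition generator_images :: "(nat \<Rightarrow> 'l \<Rightarrow> 'a::zero) \<Rightarrow> (nat \<Rightarrow> 'l) \<Rightarrow> nat \<Rightarrow> 'a" where
  "generator_images \<Phi> lam n = (if n \<ge> 2 then \<Phi> n (lam n) else 0)"


section \<open>Algebras over dg operads\<close>

record ('k, 'v) complex_struct =
  cscale :: "'k \<Rightarrow> 'v \<Rightarrow> 'v"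
  gr :: "int \<Rightarrow> 'v set"
  cdiff :: "'v \<Rightarrow> 'v"

locale cochain_complex =
  fixes V :: "('k::field, 'v::ab_group_add) complex_struct"
  assumes graded_V: "graded_space (cscale V) (gr V)"
    and cdiff_closed: "v \<in> gr V d \<Longrightarrow> cdiff V v \<in> gr V (d + 1)"
    and cdiff_linear: "linear_on (cscale V) (cscale V) (gr V d) (cdiff V)"
    and cdiff_cdiff: "v \<in> gr V d \<Longrightarrow> cdiff V (cdiff V v) = 0"

abbreviation homogeneous :: "('k, 'v) complex_struct \<Rightarrow> int list \<Rightarrow> 'v list \<Rightarrow> bool" where
  "homogeneous V ds vs \<equiv> list_all2 (\<lambda>d v. v \<in> gr V d) ds vs"

definition permute :: "(nat \<Rightarrow> nat) \<Rightarrow> 'v list \<Rightarrow> 'v list" where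
  "permute \<sigma> vs = map (\<lambda>j. vs ! (\<sigma> j - 1)) [1..<length vs + 1]"

definition koszul_sign :: "(nat \<Rightarrow> nat) \<Rightarrow> int list \<Rightarrow> 'k::field" where
  "koszul_sign \<sigma> ds = (\<Prod>(i, j) \<in> {(i, j). 1 \<le> i \<and> i < j \<and> j \<le> length ds \<and> \<sigma> j < \<sigma> i}.
     (-1) powi (ds ! (\<sigma> i - 1) * ds ! (\<sigma> j - 1)))"

text \<open>The structure map \<open>\<gamma> f [v\<^sub>1, \<dots>, v\<^sub>n] = f(v\<^sub>1, \<dots>, v\<^sub>n)\<close>; the axioms spell out that it is a morphism
  of dg operads from \<open>P\<close> to the endomorphism operad of \<open>V\<close>, with Koszul signs.\<close>

locale operad_algebra = cochain_complex V
  for P :: "('k::field, 'a::ab_group_add, 'z) dg_operad_struct_scheme"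
    and V :: "('k, 'v::ab_group_add) complex_struct"
    and \<gamma> :: "'a \<Rightarrow> 'v list \<Rightarrow> 'v" +
  assumes alg_closed: "\<lbrakk>f \<in> component P n e; length vs = n; homogeneous V ds vs\<rbrakk>
          \<Longrightarrow> \<gamma> f vs \<in> gr V (e + sum_list ds)"
    and alg_linear: "\<lbrakk>length vs = n; homogeneous V ds vs\<rbrakk>
          \<Longrightarrow> linear_on (oscale P) (cscale V) (component P n e) (\<lambda>f. \<gamma> f vs)"
    and alg_multilinear:
          "\<lbrakk>f \<in> component P n e; length us + 1 + length ws = n; homogeneous V ds us; homogeneous V cs ws\<rbrakk>
          \<Longrightarrow> linear_on (cscale V) (cscale V) (gr V b) (\<lambda>v. \<gamma> f (us @ v # ws))"
    and alg_unit: "v \<in> gr V d \<Longrightarrow> \<gamma> (unit P) [v] = v"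
    and alg_ins:
          "\<lbrakk>f \<in> component P n d; g \<in> component P m e; length us + 1 + length ws = n; length vs = m;
            homogeneous V as us; homogeneous V bs vs; homogeneous V cs ws\<rbrakk>
          \<Longrightarrow> \<gamma> (ins P n (length us + 1) m f g) (us @ vs @ ws)
            = cscale V ((-1) powi (e * sum_list as)) (\<gamma> f (us @ \<gamma> g vs # ws))"
    and alg_act: "\<lbrakk>f \<in> component P n e; \<sigma> permutes {1..n}; length vs = n; homogeneous V ds vs\<rbrakk>
          \<Longrightarrow> \<gamma> (act P n \<sigma> f) vs = cscale V (koszul_sign \<sigma> ds) (\<gamma> f (permute \<sigma> vs))"
    and alg_diff: "\<lbrakk>f \<in> component P n e; length vs = n; homogeneous V ds vs\<rbrakk>
          \<Longrightarrow> cdiff V (\<gamma> f vs) = \<gamma> (odiff P n e f) vs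
            + cscale V ((-1) powi e)
                (\<Sum>i<n. cscale V ((-1) powi sum_list (take i ds)) (\<gamma> f (vs[i := cdiff V (vs ! i)])))"


section \<open>Filtrations and Maurer--Cartan elements\<close>

text \<open>\<open>F k d\<close> is the degree \<open>d\<close> component of the \<open>k\<close>-th filtration step. Completeness is understood in
  graded vector spaces, i.e. degree by degree: the canonical map to the limit of the quotients
  \<open>gr V d / F k d\<close> is bijective.\<close>

definition complete_filtration ::
    "('k::field, 'v::ab_group_add) complex_struct \<Rightarrow> (nat \<Rightarrow> int \<Rightarrow> 'v set) \<Rightarrow> bool" where
  "complete_filtration V F \<longleftrightarrow>
     F 0 = gr V \<and>
     (\<forall>k d. module.subspace (cscale V) (F k d) \<and> F (Suc k) d \<subseteq> F k d) \<and>
     (\<forall>d x. (\<forall>k. x k \<in> gr V d \<and> x (Suc k) - x k \<in> F k d) \<longrightarrow>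
        (\<exists>!y. y \<in> gr V d \<and> (\<forall>k. y - x k \<in> F k d)))"

definition compatible_filtration ::
    "('k, 'a, 'z) dg_operad_struct_scheme \<Rightarrow> ('k, 'v::ab_group_add) complex_struct
      \<Rightarrow> ('a \<Rightarrow> 'v list \<Rightarrow> 'v) \<Rightarrow> (nat \<Rightarrow> int \<Rightarrow> 'v set) \<Rightarrow> bool" where
  "compatible_filtration P V \<gamma> F \<longleftrightarrow>
     (\<forall>k d. \<forall>v\<in>F k d. cdiff V v \<in> F k (d + 1)) \<and>
     (\<forall>n e f ks ds vs. f \<in> component P n e \<and> length ks = n \<and> length ds = n \<and> length vs = n \<and>
        (\<forall>j<n. vs ! j \<in> F (ks ! j) (ds ! j)) \<longrightarrow>
        \<gamma> f vs \<in> F (sum_list ks) (e + sum_list ds))"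

text \<open>Sums of series of homogeneous elements of one common degree, in the filtration topology.\<close>

definition filt_sums :: "(nat \<Rightarrow> int \<Rightarrow> 'v::ab_group_add set) \<Rightarrow> (nat \<Rightarrow> 'v) \<Rightarrow> 'v \<Rightarrow> bool" where
  "filt_sums F x y \<longleftrightarrow> (\<exists>d. (\<forall>r. x r \<in> F 0 d) \<and> y \<in> F 0 d \<and>
     (\<forall>k. \<exists>N. \<forall>M\<ge>N. y - (\<Sum>r<M. x r) \<in> F k d))"

definition filt_suminf :: "(nat \<Rightarrow> int \<Rightarrow> 'v::ab_group_add set) \<Rightarrow> (nat \<Rightarrow> 'v) \<Rightarrow> 'v" where
  "filt_suminf F x = (THE y. filt_sums F x y)"

definition maurer_cartan ::
    "('k::field_char_0, 'v::ab_group_add) complex_struct \<Rightarrow> ('a \<Rightarrow> 'v list \<Rightarrow> 'v) \<Rightarrow> (nat \<Rightarrow> 'a)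
      \<Rightarrow> (nat \<Rightarrow> int \<Rightarrow> 'v set) \<Rightarrow> 'v \<Rightarrow> bool" where
  "maurer_cartan V \<gamma> \<phi> F \<alpha> \<longleftrightarrow> \<alpha> \<in> F 1 2 \<and>
     cdiff V \<alpha> + filt_suminf F (\<lambda>n. if n \<ge> 2
        then cscale V (1 / fact n) (\<gamma> (\<phi> n) (replicate n \<alpha>)) else 0) = 0"


section \<open>Twisting\<close>

definition tw_ins ::
    "('k, 'a::ab_group_add, 'z) operad_struct_scheme \<Rightarrow> nat \<Rightarrow> nat \<Rightarrow> nat \<Rightarrow> (nat \<Rightarrow> 'a) \<Rightarrow> (nat \<Rightarrow> 'a)
      \<Rightarrow> (nat \<Rightarrow> 'a)" where
  "tw_ins P n i m f g = (\<lambda>r. \<Sum>p = 0..r. \<Sum>\<sigma>\<in>Sh p (r - p).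
     labelled_ins P (f p) (map \<sigma> [1..<p + 1] @ [r + 1..<r + i])
       (g (r - p)) (map \<sigma> [p + 1..<r + 1] @ [r + i..<r + i + m])
       [r + i + m..<r + n + m])"

definition tw_diff ::
    "('k::field, 'a::ab_group_add, 'z) dg_operad_struct_scheme \<Rightarrow> (nat \<Rightarrow> 'a)
      \<Rightarrow> nat \<Rightarrow> int \<Rightarrow> (nat \<Rightarrow> 'a) \<Rightarrow> (nat \<Rightarrow> 'a)" where
  "tw_diff P \<phi> n d f = (let \<kappa> = (\<lambda>r. \<phi> (r + 1)) in (\<lambda>r.
     odiff P (r + n) (d - 2 * int r) (f r)
     - oscale P ((-1) powi d) (\<Sum>p = 1..r. \<Sum>\<sigma>\<in>Sh p (r - p).
         labelled_ins P (f (r - p + 1)) [] (\<phi> p) (map \<sigma> [1..<p + 1])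
           (map \<sigma> [p + 1..<r + 1] @ [r + 1..<r + n + 1]))
     + tw_ins P 1 1 n \<kappa> f r
     - oscale P ((-1) powi d) (\<Sum>i = 1..n. tw_ins P n i 1 f \<kappa> r)))"

definition Tw ::
    "('k::field, 'a::ab_group_add, 'z) dg_operad_struct_scheme \<Rightarrow> (nat \<Rightarrow> 'a)
      \<Rightarrow> ('k, nat \<Rightarrow> 'a) dg_operad_struct" where
  "Tw P \<phi> = \<lparr>
     oscale = (\<lambda>c f r. oscale P c (f r)),
     component = (\<lambda>n d. {f. \<forall>r. f r \<in> component P (r + n) (d - 2 * int r) \<and>
                 (\<forall>\<tau>. \<tau> permutes {1..r} \<longrightarrow> act P (r + n) \<tau> (f r) = f r)}),
     act = (\<lambda>n \<sigma> f r. act P (r + n) (\<lambda>j. if j \<le> r then j else r + \<sigma> (j - r)) (f r)),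
     unit = (\<lambda>r. if r = 0 then unit P else 0),
     ins = tw_ins P,
     odiff = tw_diff P \<phi>\<rparr>"

definition twisted_diff_terms ::
    "('k::field_char_0, 'v::ab_group_add) complex_struct \<Rightarrow> ('a \<Rightarrow> 'v list \<Rightarrow> 'v) \<Rightarrow> (nat \<Rightarrow> 'a)
      \<Rightarrow> 'v \<Rightarrow> 'v \<Rightarrow> nat \<Rightarrow> 'v" where
  "twisted_diff_terms V \<gamma> \<phi> \<alpha> v = (\<lambda>r. if r \<ge> 1
     then cscale V (1 / fact r) (\<gamma> (\<phi> (r + 1)) (replicate r \<alpha> @ [v])) else 0)"

definition twisted_complex ::
    "('k::field_char_0, 'v::ab_group_add) complex_struct \<Rightarrow> ('a \<Rightarrow> 'v list \<Rightarrow> 'v) \<Rightarrow> (nat \<Rightarrow> 'a)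
      \<Rightarrow> (nat \<Rightarrow> int \<Rightarrow> 'v set) \<Rightarrow> 'v \<Rightarrow> ('k, 'v) complex_struct" where
  "twisted_complex V \<gamma> \<phi> F \<alpha> =
     V\<lparr>cdiff := (\<lambda>v. cdiff V v + filt_suminf F (twisted_diff_terms V \<gamma> \<phi> \<alpha> v))\<rparr>"

definition tw_terms ::
    "('k::field_char_0, 'v::ab_group_add) complex_struct \<Rightarrow> ('a \<Rightarrow> 'v list \<Rightarrow> 'v) \<Rightarrow> 'v
      \<Rightarrow> (nat \<Rightarrow> 'a) \<Rightarrow> 'v list \<Rightarrow> nat \<Rightarrow> 'v" where
  "tw_terms V \<gamma> \<alpha> f vs = (\<lambda>r. cscale V (1 / fact r) (\<gamma> (f r) (replicate r \<alpha> @ vs)))"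

definition tw_action ::
    "('k::field_char_0, 'v::ab_group_add) complex_struct \<Rightarrow> ('a \<Rightarrow> 'v list \<Rightarrow> 'v)
      \<Rightarrow> (nat \<Rightarrow> int \<Rightarrow> 'v set) \<Rightarrow> 'v \<Rightarrow> (nat \<Rightarrow> 'a) \<Rightarrow> 'v list \<Rightarrow> 'v" where
  "tw_action V \<gamma> F \<alpha> f vs = filt_suminf F (tw_terms V \<gamma> \<alpha> f vs)"

end

theory Submission
  imports Defs
begin

text \<open>
  Both the shuffles in the composition of the twisted operad and the factorials in the formula for
  its action count the ways of distributing several copies of \<open>\<alpha>\<close>. Since \<open>\<alpha>\<close> has even degree, a
  shuffle that only moves copies of \<open>\<alpha>\<close> produces no sign. Hence a sum over \<open>(p, r - p)\<close>-shuffles,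
  evaluated on \<open>r\<close> copies of \<open>\<alpha>\<close>, is a binomial coefficient times a single term, and the coefficient
  together with \<open>1 / r!\<close> gives \<open>1 / (p! (r - p)!)\<close>. Thus the series of
  \<open>f \<circ>\<^sub>i g\<close> results from substituting the series of \<open>g\<close> into that of \<open>f\<close> (\<open>tw_action_ins\<close>). All series involved have their \<open>r\<close>-th term in the \<open>r\<close>-th
  filtration step, because \<open>\<alpha>\<close> lies in the first one. They converge by completeness, and a double
  series whose \<open>(p, q)\<close>-th term lies in step \<open>p + q\<close> can be summed along diagonals
  (\<open>series_diagonal\<close>).

  For the differential, apply the Leibniz rule in \<open>V\<close> to each \<open>f\<^sub>r(\<alpha>, \<dots>, \<alpha>, v\<^sub>1, \<dots>, v\<^sub>n)\<close>. By the
  invariance of \<open>f\<^sub>r\<close>, the terms in which an argument \<open>\<alpha>\<close> is differentiated agree with each other, and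
  the Maurer--Cartan equation replaces \<open>\<partial>\<alpha>\<close> by minus the sum of the brackets
  \<open>\<phi>\<^sub>p(\<alpha>, \<dots>, \<alpha>) / p!\<close>. This is exactly the part of the twisted differential in which brackets are
  inserted into the first inputs (\<open>cdiff_tw_action\<close>). The other two parts insert \<open>\<kappa>\<close> at the root and at the
  remaining inputs, and account for the terms by which \<open>\<partial>\<^sup>\<alpha> = \<partial> + \<kappa>\<close> differs from \<open>\<partial>\<close>.

  That \<open>\<partial>\<^sup>\<alpha>\<close> squares to zero follows from the same computation for \<open>f = \<kappa>\<close> and from the relation
  that the defining differential of the generators imposes on \<open>\<kappa>\<close> (\<open>kappa_relation\<close>): a shuffle in this
  relation has the one argument \<open>v\<close> other than \<open>\<alpha>\<close> either in the outer or in the inner bracket, and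
  Pascal's rule separates the two contributions.
\<close>

section \<open>Signs and linear maps\<close>

lemma neg_one_powi_cong:
  "even (a - b) \<Longrightarrow> ((-1) :: 'k::field) powi a = (-1) powi b"
  by (simp add: power_int_minus_left)

lemma graded_spaceD:
  assumes "graded_space s A"
  shows "vector_space s" "module s" "module.subspace s (A d)"
    "d \<noteq> e \<Longrightarrow> x \<in> A d \<Longrightarrow> x \<in> A e \<Longrightarrow> x = 0"
  using assms unfolding graded_space_def by (auto simp: module_iff_vector_space)

lemma linear_onD:
  assumes "linear_on s t A h"
  shows "x \<in> A \<Longrightarrow> y \<in> A \<Longrightarrow> h (x + y) = h x + h y" "x \<in> A \<Longrightarrow> h (s c x) = t c (h x)"
  using assms unfolding linear_on_def by auto

lemma linear_on_zero:
  assumes "linear_on s t A h" "module s" "module.subspace s A"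
  shows "h 0 = 0"
  using linear_onD(1)[OF assms(1), of 0 0] module.subspace_0[OF assms(2,3)] by simp

lemma linear_on_neg:
  assumes "linear_on s t A h" "module s" "module.subspace s A" "x \<in> A"
  shows "h (- x) = - h x"
proof -
  have "h x + h (- x) = h (x + - x)"
    using linear_onD(1)[OF assms(1,4)] module.subspace_neg[OF assms(2,3,4)] by metis
  also have "\<dots> = 0" using linear_on_zero[OF assms(1-3)] by simp
  finally show ?thesis by (simp add: add_eq_0_iff)
qed

lemma linear_on_diff:
  assumes "linear_on s t A h" "module s" "module.subspace s A" "x \<in> A" "y \<in> A"
  shows "h (x - y) = h x - h y"
  using linear_onD(1)[OF assms(1,4) module.subspace_neg[OF assms(2,3,5)]]
    linear_on_neg[OF assms(1-3,5)] by simp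

lemma linear_on_sum:
  assumes "linear_on s t A h" "module s" "module.subspace s A" "\<And>i. i \<in> I \<Longrightarrow> x i \<in> A"
  shows "h (\<Sum>i\<in>I. x i) = (\<Sum>i\<in>I. h (x i))"
  using assms(4)
proof (induction I rule: infinite_finite_induct)
  case (insert i I)
  have "(\<Sum>i\<in>I. x i) \<in> A"
    using insert.prems by (intro module.subspace_sum[OF assms(2,3)]) auto
  then show ?case
    using insert linear_onD(1)[OF assms(1)] by simp
qed (use linear_on_zero[OF assms(1-3)] in auto)


section \<open>Shuffles\<close>

lemma finite_Sh [simp]: "finite (Sh p q)"
  by (rule finite_subset[of _ "{\<sigma>. \<sigma> permutes {1..p + q}}"])
    (auto simp: Sh_def finite_permutations)

lemma strict_mono_on_determined_by_image:
  fixes f g :: "nat \<Rightarrow> nat"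
  assumes "strict_mono_on {a..<b} f" "strict_mono_on {a..<b} g" "f ` {a..<b} = g ` {a..<b}"
    "x \<in> {a..<b}"
  shows "f x = g x"
proof -
  have "sorted_wrt (<) (map f [a..<b])" if "strict_mono_on {a..<b} f" for f :: "nat \<Rightarrow> nat"
    unfolding sorted_wrt_map
    by (rule sorted_wrt_mono_rel[OF _ sorted_wrt_upt]) (use that in \<open>auto intro: strict_mono_onD\<close>)
  then have "map f [a..<b] = map g [a..<b]"
    using assms(1-3) by (intro strict_sorted_equal) auto
  then show ?thesis using assms(4) by auto
qed

lemma image_nth_pred: "(\<lambda>j. xs ! (j - 1)) ` {1..length xs} = set xs"
proof -
  have "{1..length xs} = Suc ` {..<length xs}"
    by (simp add: image_Suc_lessThan)
  then show ?thesis by (auto simp: image_image set_conv_nth)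
qed

lemma list_perm_permutes:
  assumes "distinct ls" "set ls = {1..length ls}"
  shows "list_perm ls permutes {1..length ls}"
proof (rule bij_imp_permutes)
  have "bij_betw (\<lambda>j. ls ! (j - 1)) {1..length ls} {1..length ls}"
    unfolding bij_betw_def
  proof (intro conjI)
    show "inj_on (\<lambda>j. ls ! (j - 1)) {1..length ls}"
      using assms(1) by (auto simp: inj_on_def nth_eq_iff_index_eq)
    show "(\<lambda>j. ls ! (j - 1)) ` {1..length ls} = {1..length ls}"
      using assms(2) image_nth_pred by metis
  qed
  then show "bij_betw (list_perm ls) {1..length ls} {1..length ls}"
    by (rule bij_betw_cong[THEN iffD1, rotated]) (auto simp: list_perm_def)
qed (auto simp: list_perm_def)

text \<open>A shuffle is determined by its first block, because both blocks are listed in increasing order,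
  and any subset of the right size can be that block.\<close>

lemma bij_betw_Sh:
  "bij_betw (\<lambda>\<sigma>. \<sigma> ` {1..p}) (Sh p q) {A. A \<subseteq> {1..p + q} \<and> card A = p}"
  unfolding bij_betw_def
proof (intro conjI)
  show "inj_on (\<lambda>\<sigma>. \<sigma> ` {1..p}) (Sh p q)"
  proof (rule inj_onI)
    fix \<sigma> \<tau> assume \<sigma>: "\<sigma> \<in> Sh p q" and \<tau>: "\<tau> \<in> Sh p q" and eq: "\<sigma> ` {1..p} = \<tau> ` {1..p}"
    have block2: "\<rho> ` {p + 1..<p + q + 1} = {1..p + q} - \<rho> ` {1..p}" if "\<rho> \<in> Sh p q" for \<rho>
    proof -
      have "\<rho> permutes {1..p + q}" using that by (simp add: Sh_def)
      then have "\<rho> ` ({1..p + q} - {1..p}) = {1..p + q} - \<rho> ` {1..p}"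
        by (metis permutes_image permutes_inj image_set_diff)
      moreover have "{1..p + q} - {1..p} = {p + 1..<p + q + 1}" by auto
      ultimately show ?thesis by simp
    qed
    have int: "{1..p} = {1..<p + 1}" "{p + 1..p + q} = {p + 1..<p + q + 1}" by auto
    show "\<sigma> = \<tau>"
    proof
      fix x
      consider "x \<in> {1..<p + 1}" | "x \<in> {p + 1..<p + q + 1}" | "x \<notin> {1..p + q}" by fastforce
      then show "\<sigma> x = \<tau> x"
      proof cases
        case 1
        then show ?thesis
          using \<sigma> \<tau> eq unfolding Sh_def int
          by (intro strict_mono_on_determined_by_image[of 1 "p + 1" \<sigma> \<tau>]) auto
      next
        case 2
        then show ?thesis
          using \<sigma> \<tau> block2[OF \<sigma>] block2[OF \<tau>] eq unfolding Sh_def int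
          by (intro strict_mono_on_determined_by_image[of "p + 1" "p + q + 1" \<sigma> \<tau>]) auto
      next
        case 3
        then have "\<rho> x = x" if "\<rho> \<in> Sh p q" for \<rho>
          using that unfolding Sh_def by (blast intro: permutes_not_in)
        from this[OF \<sigma>] this[OF \<tau>] show ?thesis by simp
      qed
    qed
  qed
next
  show "(\<lambda>\<sigma>. \<sigma> ` {1..p}) ` Sh p q = {A. A \<subseteq> {1..p + q} \<and> card A = p}"
  proof (intro equalityI subsetI)
    fix A assume "A \<in> (\<lambda>\<sigma>. \<sigma> ` {1..p}) ` Sh p q"
    then obtain \<sigma> where \<sigma>: "\<sigma> permutes {1..p + q}" and A: "A = \<sigma> ` {1..p}" by (auto simp: Sh_def)
    have "\<sigma> ` {1..p} \<subseteq> \<sigma> ` {1..p + q}" by (rule image_mono) simp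
    moreover have "card (\<sigma> ` {1..p}) = p"
      using card_image[OF permutes_inj_on[OF \<sigma>]] by simp
    ultimately show "A \<in> {A. A \<subseteq> {1..p + q} \<and> card A = p}"
      by (simp only: A permutes_image[OF \<sigma>] mem_Collect_eq simp_thms)
  next
    fix A assume "A \<in> {A. A \<subseteq> {1..p + q} \<and> card A = p}"
    then have A: "A \<subseteq> {1..p + q}" "card A = p" by auto
    have fin: "finite A" using A(1) by (rule finite_subset) simp
    define B where "B = {1..p + q} - A"
    have B: "finite B" "card B = q" using A fin by (auto simp: B_def card_Diff_subset)
    define xs where "xs = sorted_list_of_set A"
    define ys where "ys = sorted_list_of_set B"
    have len: "length xs = p" "length ys = q" using A B fin by (auto simp: xs_def ys_def)
    have set_eq: "set xs = A" "set ys = B" using B fin by (auto simp: xs_def ys_def)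
    have srt: "sorted_wrt (<) xs" "sorted_wrt (<) ys" by (simp_all add: xs_def ys_def)
    have perm: "list_perm (xs @ ys) permutes {1..p + q}"
      using list_perm_permutes[of "xs @ ys"] len set_eq A(1)
      by (auto simp: B_def xs_def ys_def)
    have first: "list_perm (xs @ ys) j = xs ! (j - 1)" if "j \<in> {1..p}" for j
      using that len by (auto simp: list_perm_def nth_append)
    have second: "list_perm (xs @ ys) j = ys ! (j - p - 1)" if "j \<in> {p + 1..p + q}" for j
    proof -
      have "j - Suc 0 - p = j - p - Suc 0" by simp
      then show ?thesis using that len by (auto simp: list_perm_def nth_append)
    qed
    have "list_perm (xs @ ys) \<in> Sh p q"
      unfolding Sh_def
    proof (intro CollectI conjI perm)
      show "strict_mono_on {1..p} (list_perm (xs @ ys))"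
        using srt(1) len
        by (intro strict_mono_onI) (simp add: first sorted_wrt_iff_nth_less)
      show "strict_mono_on {p + 1..p + q} (list_perm (xs @ ys))"
        using srt(2) len
        by (intro strict_mono_onI) (simp add: second sorted_wrt_iff_nth_less)
    qed
    moreover have "list_perm (xs @ ys) ` {1..p} = A"
    proof -
      have "list_perm (xs @ ys) ` {1..p} = (\<lambda>j. xs ! (j - 1)) ` {1..p}" using first by auto
      also have "\<dots> = A" using image_nth_pred[of xs] len(1) set_eq(1) by simp
      finally show ?thesis .
    qed
    ultimately show "A \<in> (\<lambda>\<sigma>. \<sigma> ` {1..p}) ` Sh p q" by blast
  qed
qed

lemma card_Sh: "card (Sh p q) = (p + q) choose p"
  using bij_betw_same_card[OF bij_betw_Sh[of p q]] by (simp add: n_subsets)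

text \<open>The largest letter of a shuffle ends one of the two blocks; the number of shuffles of either
  kind is the corresponding summand of Pascal's rule.\<close>

lemma card_Sh_last_in_second:
  assumes "p \<le> n"
  shows "card {\<sigma> \<in> Sh p (Suc n - p). Suc n \<notin> \<sigma> ` {1..p}} = n choose p"
proof -
  have "bij_betw (\<lambda>\<sigma>. \<sigma> ` {1..p}) {\<sigma> \<in> Sh p (Suc n - p). Suc n \<notin> \<sigma> ` {1..p}}
      {A \<in> {A. A \<subseteq> {1..Suc n} \<and> card A = p}. Suc n \<notin> A}"
    using bij_betw_Sh[of p "Suc n - p"] assms by (intro bij_betw_Collect) auto
  moreover have "{A \<in> {A. A \<subseteq> {1..Suc n} \<and> card A = p}. Suc n \<notin> A}
      = {A. A \<subseteq> {1..n} \<and> card A = p}"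
    by (auto simp: atLeastAtMostSuc_conv)
  ultimately show ?thesis
    by (simp add: bij_betw_same_card n_subsets)
qed

lemma card_Sh_last_in_first:
  assumes "1 \<le> p" "p \<le> n"
  shows "card {\<sigma> \<in> Sh p (Suc n - p). Suc n \<in> \<sigma> ` {1..p}} = n choose (p - 1)"
proof -
  let ?S = "Sh p (Suc n - p)"
  have "card ?S = card ({\<sigma> \<in> ?S. Suc n \<in> \<sigma> ` {1..p}} \<union> {\<sigma> \<in> ?S. Suc n \<notin> \<sigma> ` {1..p}})"
    by (rule arg_cong[of _ _ card]) auto
  also have "\<dots> = card {\<sigma> \<in> ?S. Suc n \<in> \<sigma> ` {1..p}} + card {\<sigma> \<in> ?S. Suc n \<notin> \<sigma> ` {1..p}}"
    by (rule card_Un_disjoint) auto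
  finally have "Suc n choose p = card {\<sigma> \<in> ?S. Suc n \<in> \<sigma> ` {1..p}} + (n choose p)"
    using card_Sh[of p "Suc n - p"] card_Sh_last_in_second[OF assms(2)] assms by simp
  then show ?thesis using assms by (cases p) auto
qed

lemma Sh_last_in_second:
  assumes "\<sigma> \<in> Sh p (Suc n - p)" "p \<le> n" "Suc n \<notin> \<sigma> ` {1..p}"
  shows "\<sigma> (Suc n) = Suc n"
proof -
  have \<sigma>: "\<sigma> permutes {1..Suc n}" and mono: "strict_mono_on {p + 1..Suc n} \<sigma>"
    using assms(1,2) by (auto simp: Sh_def)
  obtain j where j: "j \<in> {1..Suc n}" "\<sigma> j = Suc n"
    using permutes_image[OF \<sigma>] by (metis atLeastAtMost_iff imageE le_add1 order_refl plus_1_eq_Suc)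
  have "j \<notin> {1..p}" using assms(3) j(2) by force
  then have "j \<in> {p + 1..Suc n}" using j(1) by auto
  moreover have "\<sigma> (Suc n) \<le> Suc n" using permutes_in_image[OF \<sigma>, of "Suc n"] by auto
  ultimately show ?thesis
    using strict_mono_onD[OF mono, of j "Suc n"] j by (cases "j = Suc n") auto
qed

lemma Sh_last_in_first:
  assumes "\<sigma> \<in> Sh p (Suc n - p)" "p \<le> n" "Suc n \<in> \<sigma> ` {1..p}"
  shows "1 \<le> p" "\<sigma> p = Suc n"
proof -
  have \<sigma>: "\<sigma> permutes {1..Suc n}" and mono: "strict_mono_on {1..p} \<sigma>"
    using assms(1,2) by (auto simp: Sh_def)
  obtain j where j: "j \<in> {1..p}" "\<sigma> j = Suc n" using assms(3) by (metis imageE)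
  show "1 \<le> p" using j by auto
  moreover have "\<sigma> p \<le> Suc n" using permutes_in_image[OF \<sigma>, of p] calculation assms(2) by auto
  ultimately show "\<sigma> p = Suc n"
    using strict_mono_onD[OF mono, of j p] j by (cases "j = p") auto
qed

section \<open>Koszul signs and lists of arguments\<close>

lemma koszul_sign_eq_1:
  assumes "\<And>i j. 1 \<le> i \<Longrightarrow> i < j \<Longrightarrow> j \<le> length ds \<Longrightarrow> \<sigma> j < \<sigma> i \<Longrightarrow>
    even (ds ! (\<sigma> i - 1) * ds ! (\<sigma> j - 1))"
  shows "koszul_sign \<sigma> ds = 1"
  unfolding koszul_sign_def by (rule prod.neutral) (use assms in \<open>auto simp: power_int_minus_left\<close>)

lemma length_permute [simp]: "length (permute \<sigma> vs) = length vs"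
  by (simp add: permute_def del: upt_Suc)

lemma nth_permute: "i < length vs \<Longrightarrow> permute \<sigma> vs ! i = vs ! (\<sigma> (Suc i) - 1)"
  by (simp add: permute_def del: upt_Suc)

text \<open>Labels of inputs count from 1, positions in lists from 0.\<close>

definition entry :: "'v list \<Rightarrow> nat \<Rightarrow> 'v" where
  "entry vs l = vs ! (l - 1)"

lemma map_entry_upt:
  assumes "length us = a - 1" "length vs = b - a" "1 \<le> a"
  shows "map (entry (us @ vs @ ws)) [a..<b] = vs"
  by (rule nth_equalityI) (use assms in \<open>auto simp: entry_def nth_append\<close>)

lemma map_entry_const:
  assumes "set ls \<subseteq> {1..r}"
  shows "map (entry (replicate r x @ vs)) ls = replicate (length ls) x"
proof -
  have "entry (replicate r x @ vs) l = x" if "l \<in> set ls" for l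
    using assms that by (force simp: entry_def nth_append)
  then show ?thesis by (simp add: map_replicate_const[symmetric])
qed

lemma permute_list_perm:
  assumes "length ls = length vs"
  shows "permute (list_perm ls) vs = map (entry vs) ls"
  by (rule nth_equalityI) (use assms in \<open>auto simp: nth_permute list_perm_def entry_def\<close>)

lemma koszul_sign_list_perm:
  assumes "length ls = length ds"
    and "sorted_wrt (\<lambda>a b. b < a \<longrightarrow> even (entry ds a * entry ds b)) ls"
  shows "koszul_sign (list_perm ls) ds = 1"
proof (rule koszul_sign_eq_1)
  fix i j assume ij: "1 \<le> i" "i < j" "j \<le> length ds" "list_perm ls j < list_perm ls i"
  then show "even (ds ! (list_perm ls i - 1) * ds ! (list_perm ls j - 1))"
    using sorted_wrt_nth_less[OF assms(2), of "i - 1" "j - 1"] assms(1)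
    by (auto simp: list_perm_def entry_def)
qed

lemma list_all2_entry:
  assumes "list_all2 R ds xs" "l \<in> {1..length xs}"
  shows "R (entry ds l) (entry xs l)"
  using assms by (auto simp: entry_def list_all2_conv_all_nth)

lemma list_all2_map_entry:
  assumes "list_all2 R ds xs" "set ls \<subseteq> {1..length xs}"
  shows "list_all2 R (map (entry ds) ls) (map (entry xs) ls)"
  using assms(2) list_all2_entry[OF assms(1)]
  by (auto simp: list_all2_map1 list_all2_map2 subset_eq intro!: list.rel_refl_strong)

text \<open>The permutation of \<open>r + n\<close> inputs through which a permutation of \<open>n\<close> inputs acts on the twisted
  operad.\<close>

definition shift_perm :: "nat \<Rightarrow> (nat \<Rightarrow> nat) \<Rightarrow> nat \<Rightarrow> nat" where
  "shift_perm r \<sigma> = (\<lambda>j. if j \<le> r then j else r + \<sigma> (j - r))"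

lemma permutes_pos:
  assumes "\<sigma> permutes {1..n::nat}" "0 < j"
  shows "0 < \<sigma> j"
  using permutes_in_image[OF assms(1), of j] permutes_not_in[OF assms(1), of j] assms(2)
  by (cases "j \<le> n") auto

lemma shift_perm_permutes:
  assumes "\<sigma> permutes {1..n}"
  shows "shift_perm r \<sigma> permutes {1..r + n}"
proof (rule inj_imp_permutes)
  show "inj_on (shift_perm r \<sigma>) {1..r + n}"
  proof (rule inj_onI)
    note pos = permutes_pos[OF assms]
    fix x y assume "shift_perm r \<sigma> x = shift_perm r \<sigma> y"
    then show "x = y"
      using pos[of "x - r"] pos[of "y - r"] inj_eq[OF permutes_inj[OF assms], of "x - r" "y - r"]
      by (auto simp: shift_perm_def split: if_splits)
  qed
  fix x
  show "x \<in> {1..r + n} \<Longrightarrow> shift_perm r \<sigma> x \<in> {1..r + n}"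
    using permutes_in_image[OF assms, of "x - r"] by (auto simp: shift_perm_def)
  show "shift_perm r \<sigma> x = x" if "x \<notin> {1..r + n}"
  proof (cases "x \<le> r")
    case False
    then have "x - r \<notin> {1..n}" using that by auto
    then show ?thesis using permutes_not_in[OF assms] False by (simp add: shift_perm_def)
  qed (simp add: shift_perm_def)
qed simp

lemma permute_shift_perm:
  assumes "\<sigma> permutes {1..length vs}"
  shows "permute (shift_perm (length us) \<sigma>) (us @ vs) = us @ permute \<sigma> vs"
proof (rule nth_equalityI)
  fix i assume i: "i < length (permute (shift_perm (length us) \<sigma>) (us @ vs))"
  show "permute (shift_perm (length us) \<sigma>) (us @ vs) ! i = (us @ permute \<sigma> vs) ! i"
  proof (cases "i < length us")
    case True
    then show ?thesis using i by (simp add: nth_permute shift_perm_def nth_append)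
  next
    case False
    with i have lt: "i - length us < length vs" by simp
    have "1 \<le> \<sigma> (Suc i - length us)"
      using permutes_in_image[OF assms, of "Suc i - length us"] False lt by auto
    then show ?thesis
      using False lt i by (auto simp: nth_permute shift_perm_def nth_append Suc_diff_le)
  qed
qed simp

lemma koszul_sign_shift_perm:
  assumes "\<sigma> permutes {1..length ds}"
  shows "koszul_sign (shift_perm (length cs) \<sigma>) (cs @ ds) = koszul_sign \<sigma> ds"
  unfolding koszul_sign_def
proof (rule prod.reindex_bij_witness[where i = "\<lambda>(i, j). (length cs + i, length cs + j)"
      and j = "\<lambda>(i, j). (i - length cs, j - length cs)"], goal_cases)
  {
    case (5 a)
    then obtain i j where a: "a = (i, j)" and ij: "1 \<le> i" "i < j" "j \<le> length (cs @ ds)"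
      "shift_perm (length cs) \<sigma> j < shift_perm (length cs) \<sigma> i" by auto
    then have gt: "length cs < i"
      by (auto simp: shift_perm_def split: if_splits)
    have "0 < \<sigma> (i - length cs)" "0 < \<sigma> (j - length cs)"
      using gt ij by (auto intro!: permutes_pos[OF assms])
    then have "(cs @ ds) ! (shift_perm (length cs) \<sigma> i - 1) = ds ! (\<sigma> (i - length cs) - 1)"
      "(cs @ ds) ! (shift_perm (length cs) \<sigma> j - 1) = ds ! (\<sigma> (j - length cs) - 1)"
      using gt ij(2) Suc_le_eq by (auto simp: shift_perm_def nth_append)
    then show ?case by (simp add: a)
  next
    case (1 a)
    then show ?case by (auto simp: shift_perm_def split: if_splits)
  next
    case (2 a)
    then show ?case by (auto simp: shift_perm_def split: if_splits)
  next
    case (3 a)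
    then show ?case by auto
  next
    case (4 a)
    then show ?case by (auto simp: shift_perm_def)
  }
qed

section \<open>Series in complete filtered graded vector spaces\<close>

locale complete_filtered_space =
  fixes V :: "('k::field, 'v::ab_group_add) complex_struct"
    and F :: "nat \<Rightarrow> int \<Rightarrow> 'v set"
  assumes graded_space_V: "graded_space (cscale V) (gr V)"
    and complete: "complete_filtration V F"
begin

sublocale vec: vector_space "cscale V"
  using graded_spaceD(1)[OF graded_space_V] .

lemma F_0: "F 0 = gr V"
  using complete by (simp add: complete_filtration_def)

lemma subspace_F: "vec.subspace (F k d)"
  using complete by (simp add: complete_filtration_def)

lemmas F_zero [simp] = vec.subspace_0[OF subspace_F]
  and F_add = vec.subspace_add[OF subspace_F]
  and F_diff = vec.subspace_diff[OF subspace_F]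
  and F_scale = vec.subspace_scale[OF subspace_F]
  and F_sum = vec.subspace_sum[OF subspace_F]

lemma F_antimono: "k \<le> l \<Longrightarrow> x \<in> F l d \<Longrightarrow> x \<in> F k d"
proof (induction l arbitrary: x rule: dec_induct)
  case (step l)
  then show ?case using complete by (auto simp: complete_filtration_def)
qed auto

lemma F_gr: "x \<in> F k d \<Longrightarrow> x \<in> gr V d"
  using F_antimono[of 0 k] by (simp add: F_0)

lemma separated:
  assumes "\<And>k. x \<in> F k d"
  shows "x = 0"
proof -
  have "\<exists>!y. y \<in> gr V d \<and> (\<forall>k. y - (0 :: 'v) \<in> F k d)"
    using complete F_gr[OF F_zero] unfolding complete_filtration_def by (elim conjE allE[of _ d] allE[of _ "\<lambda>_. 0"]) auto
  then show ?thesis using assms F_gr[OF assms] F_gr[OF F_zero] by (metis F_zero diff_zero)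
qed

text \<open>All series below have their \<open>r\<close>-th term in the \<open>r\<close>-th filtration step. For these, convergence is
  the same as the explicit remainder estimate, which turns the manipulation of series into finite
  sums modulo a filtration step.\<close>

definition series :: "int \<Rightarrow> (nat \<Rightarrow> 'v) \<Rightarrow> 'v \<Rightarrow> bool" where
  "series d x y \<longleftrightarrow> (\<forall>r. x r \<in> F r d) \<and> (\<forall>M. y - (\<Sum>r<M. x r) \<in> F M d)"

lemma seriesD:
  assumes "series d x y"
  shows "x r \<in> F r d" "y - (\<Sum>r<M. x r) \<in> F M d" "y \<in> gr V d"
  using assms spec[of "\<lambda>M. y - (\<Sum>r<M. x r) \<in> F M d" 0] by (auto simp: series_def F_0)

lemma series_exists:
  assumes "\<And>r. x r \<in> F r d"
  obtains y where "series d x y"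
proof -
  have "(\<Sum>r<k. x r) \<in> gr V d" for k
    using F_sum[of "{..<k}" x 0 d] F_gr[OF assms] by (simp add: F_0)
  then have "\<exists>!y. y \<in> gr V d \<and> (\<forall>k. y - (\<Sum>r<k. x r) \<in> F k d)"
    using complete assms unfolding complete_filtration_def
    by (elim conjE allE[of _ d] allE[of _ "\<lambda>k. \<Sum>r<k. x r"]) auto
  with that assms show ?thesis by (auto simp: series_def)
qed

lemma filt_sums_unique:
  assumes "filt_sums F x y" "filt_sums F x z"
  shows "y = z"
proof -
  obtain d where d: "\<And>r. x r \<in> F 0 d" "y \<in> F 0 d" "\<And>k. \<exists>N. \<forall>M\<ge>N. y - (\<Sum>r<M. x r) \<in> F k d"
    using assms(1) by (auto simp: filt_sums_def)
  obtain e where e: "\<And>r. x r \<in> F 0 e" "z \<in> F 0 e" "\<And>k. \<exists>N. \<forall>M\<ge>N. z - (\<Sum>r<M. x r) \<in> F k e"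
    using assms(2) by (auto simp: filt_sums_def)
  show ?thesis
  proof (cases "d = e")
    case True
    have "y - z \<in> F k d" for k
    proof -
      obtain N where N: "\<And>M. M \<ge> N \<Longrightarrow> y - (\<Sum>r<M. x r) \<in> F k d" using d(3) by blast
      obtain N' where N': "\<And>M. M \<ge> N' \<Longrightarrow> z - (\<Sum>r<M. x r) \<in> F k d" using e(3) True by blast
      show ?thesis
        using F_diff[OF N[of "max N N'"] N'[of "max N N'"]] by simp
    qed
    then show ?thesis using separated[of "y - z" d] by simp
  next
    case False
    \<comment> \<open>Then all terms lie in two components, hence vanish, and so do both sums.\<close>
    have "x r = 0" for r
      using graded_spaceD(4)[OF graded_space_V False] d(1) e(1) by (simp add: F_0)
    then have "y = 0" "z = 0"
      using d(3) e(3) by (auto intro!: separated)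
    then show ?thesis by simp
  qed
qed

lemma series_imp_filt_sums:
  assumes "series d x y"
  shows "filt_sums F x y"
  unfolding filt_sums_def
proof (intro exI[of _ d] conjI allI)
  show "x r \<in> F 0 d" for r using seriesD(1)[OF assms] F_antimono by blast
  show "y \<in> F 0 d" using seriesD(3)[OF assms] by (simp add: F_0)
  show "\<exists>N. \<forall>M\<ge>N. y - (\<Sum>r<M. x r) \<in> F k d" for k
    using seriesD(2)[OF assms] F_antimono by blast
qed

lemma filt_suminf_eq:
  assumes "series d x y"
  shows "filt_suminf F x = y"
  unfolding filt_suminf_def
  using series_imp_filt_sums[OF assms] filt_sums_unique by blast

lemma series_filt_suminf:
  assumes "\<And>r. x r \<in> F r d"
  shows "series d x (filt_suminf F x)"
  using series_exists[OF assms] filt_suminf_eq by metis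

lemma series_unique: "series d x y \<Longrightarrow> series d x z \<Longrightarrow> y = z"
  using filt_suminf_eq by metis

lemma series_add: "series d x y \<Longrightarrow> series d x' y' \<Longrightarrow> series d (\<lambda>r. x r + x' r) (y + y')"
  unfolding series_def by (auto intro: F_add simp: sum.distrib add_diff_add)

lemma series_scale: "series d x y \<Longrightarrow> series d (\<lambda>r. cscale V c (x r)) (cscale V c y)"
  unfolding series_def
  by (auto intro: F_scale simp: vec.scale_sum_right[symmetric] vec.scale_right_diff_distrib[symmetric])

lemma series_neg: "series d x y \<Longrightarrow> series d (\<lambda>r. - x r) (- y)"
  using series_scale[of d x y "-1"] by simp

lemma series_zero: "series d (\<lambda>r. 0) 0"
  by (simp add: series_def)

lemma series_sum:
  assumes "\<And>i. i \<in> I \<Longrightarrow> series d (x i) (y i)"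
  shows "series d (\<lambda>r. \<Sum>i\<in>I. x i r) (\<Sum>i\<in>I. y i)"
  using assms by (induction I rule: infinite_finite_induct) (auto intro: series_add series_zero)

lemma series_single: "v \<in> gr V d \<Longrightarrow> series d (\<lambda>r. if r = 0 then v else 0) v"
  by (auto simp: series_def F_0 sum.delta)

lemma series_map_remainder:
  assumes "linear_on (cscale V) (cscale V) (gr V b) h"
    and "\<And>k v. v \<in> F k b \<Longrightarrow> h v \<in> F (k + j) c"
    and "series b x y"
  shows "h y - (\<Sum>r<M. h (x r)) \<in> F (M + j) c"
proof -
  have x: "x r \<in> gr V b" for r using seriesD(1)[OF assms(3)] F_gr by blast
  have sub: "vec.subspace (gr V b)" using subspace_F[of 0] by (simp add: F_0)
  have "h (y - (\<Sum>r<M. x r)) = h y - (\<Sum>r<M. h (x r))"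
    by (simp only: linear_on_diff[OF assms(1) vec.module_axioms sub seriesD(3)[OF assms(3)]
        vec.subspace_sum[OF sub x]] linear_on_sum[OF assms(1) vec.module_axioms sub x])
  then show ?thesis using assms(2)[OF seriesD(2)[OF assms(3), of M]] by simp
qed

lemma series_map:
  assumes "linear_on (cscale V) (cscale V) (gr V b) h"
    and "\<And>k v. v \<in> F k b \<Longrightarrow> h v \<in> F k c"
    and "series b x y"
  shows "series c (\<lambda>r. h (x r)) (h y)"
  using series_map_remainder[of b h 0 c x y] assms seriesD(1)[OF assms(3)]
  by (auto simp: series_def)

text \<open>A double series whose \<open>(p,q)\<close>-th term lies in step \<open>p + q\<close> may be summed along diagonals: modulo
  step \<open>M\<close> only the finitely many terms with \<open>p + q < M\<close> matter.\<close>

lemma series_diagonal: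
  assumes "series d z y"
    and terms: "\<And>p q. x p q \<in> F (p + q) d"
    and rows: "\<And>p M. z p - (\<Sum>q<M. x p q) \<in> F (p + M) d"
  shows "series d (\<lambda>r. \<Sum>p\<le>r. x p (r - p)) y"
  unfolding series_def
proof (intro conjI allI)
  show "(\<Sum>p\<le>r. x p (r - p)) \<in> F r d" for r
    by (rule F_sum) (use terms[of _ "r - _"] in \<open>metis atMost_iff le_add_diff_inverse\<close>)
  fix M
  have "(\<Sum>r<M. \<Sum>p\<le>r. x p (r - p)) = (\<Sum>p<M. \<Sum>q<M - p. x p q)"
  proof -
    have "(\<Sum>r<M. \<Sum>p\<le>r. x p (r - p)) = (\<Sum>(r, p)\<in>(SIGMA r:{..<M}. {..r}). x p (r - p))"
      by (rule sum.Sigma) auto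
    also have "\<dots> = (\<Sum>(p, q)\<in>(SIGMA p:{..<M}. {..<M - p}). x p q)"
      by (rule sum.reindex_bij_witness[where i = "\<lambda>(p, q). (p + q, p)" and j = "\<lambda>(r, p). (p, r - p)"]) auto
    also have "\<dots> = (\<Sum>p<M. \<Sum>q<M - p. x p q)"
      by (rule sum.Sigma[symmetric]) auto
    finally show ?thesis .
  qed
  then have "y - (\<Sum>r<M. \<Sum>p\<le>r. x p (r - p))
      = (y - (\<Sum>p<M. z p)) + (\<Sum>p<M. z p - (\<Sum>q<M - p. x p q))"
    by (simp add: sum_subtractf)
  also have "\<dots> \<in> F M d"
  proof (intro F_add F_sum seriesD(2)[OF assms(1)])
    fix p assume "p \<in> {..<M}"
    then show "z p - (\<Sum>q<M - p. x p q) \<in> F M d" using rows[of p "M - p"] by simp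
  qed
  finally show "y - (\<Sum>r<M. \<Sum>p\<le>r. x p (r - p)) \<in> F M d" .
qed

lemma series_shift:
  assumes "series d x y" "\<And>r. x r \<in> F (Suc r) d"
  shows "series d (\<lambda>r. case r of 0 \<Rightarrow> 0 | Suc r \<Rightarrow> x r) y"
  unfolding series_def
proof (intro conjI allI)
  show "(case r of 0 \<Rightarrow> 0 | Suc r \<Rightarrow> x r) \<in> F r d" for r
    using assms(2) by (cases r) auto
  show "y - (\<Sum>r<M. case r of 0 \<Rightarrow> 0 | Suc r \<Rightarrow> x r) \<in> F M d" for M
  proof (cases M)
    case 0
    then show ?thesis using seriesD(3)[OF assms(1)] by (simp add: F_0)
  next
    case (Suc m)
    have "y - (\<Sum>r<m. x r) = (y - (\<Sum>r<Suc m. x r)) + x m" by simp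
    also have "\<dots> \<in> F (Suc m) d"
      using seriesD(2)[OF assms(1), of "Suc m"] assms(2) by (intro F_add)
    finally show ?thesis by (simp add: Suc sum.lessThan_Suc_shift del: sum.lessThan_Suc)
  qed
qed

end

section \<open>Composites evaluated on copies of an even element\<close>

text \<open>Here \<open>\<alpha>\<close> is an arbitrary element of degree 2 in the first filtration step: its even degree makes
  the signs trivial, and its filtration step makes the series converge.\<close>

locale filtered_algebra =
  dg_operad P + operad_algebra P V \<gamma> + complete_filtered_space V F
  for P :: "('k::field_char_0, 'a::ab_group_add, 'z) dg_operad_struct_scheme"
    and V :: "('k, 'v::ab_group_add) complex_struct"
    and \<gamma> :: "'a \<Rightarrow> 'v list \<Rightarrow> 'v"
    and F :: "nat \<Rightarrow> int \<Rightarrow> 'v set" +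
  fixes \<alpha> :: 'v
  assumes compatible: "compatible_filtration P V \<gamma> F"
    and alpha_F: "\<alpha> \<in> F 1 2"
begin

sublocale op: vector_space "oscale P"
  using graded_spaceD(1)[OF graded] .

lemma subspace_component: "op.subspace (component P n d)"
  using graded_spaceD(3)[OF graded] .

lemmas component_zero [simp] = op.subspace_0[OF subspace_component]
  and component_add = op.subspace_add[OF subspace_component]
  and component_scale = op.subspace_scale[OF subspace_component]
  and component_sum = op.subspace_sum[OF subspace_component]

lemma subspace_gr: "vec.subspace (gr V d)"
  using subspace_F[of 0] by (simp add: F_0)

lemmas gr_zero [simp] = vec.subspace_0[OF subspace_gr]

lemma gamma_zero [simp]:
  assumes "homogeneous V ds vs"
  shows "\<gamma> 0 vs = 0"
  using linear_on_zero[OF alg_linear[OF refl assms] op.module_axioms subspace_component[of _ 0]] .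

lemma gamma_neg:
  assumes "f \<in> component P (length vs) e" "homogeneous V ds vs"
  shows "\<gamma> (- f) vs = - \<gamma> f vs"
  using linear_on_neg[OF alg_linear[OF refl assms(2)] op.module_axioms subspace_component assms(1)] .

lemma gamma_sum:
  assumes "\<And>i. i \<in> I \<Longrightarrow> f i \<in> component P (length vs) e" "homogeneous V ds vs"
  shows "\<gamma> (\<Sum>i\<in>I. f i) vs = (\<Sum>i\<in>I. \<gamma> (f i) vs)"
  by (rule linear_on_sum[OF alg_linear[OF refl assms(2)] op.module_axioms subspace_component])
    (rule assms(1))

lemma gamma_slot_linear:
  assumes "f \<in> component P n e" "length us + 1 + length ws = n"
    "homogeneous V as us" "homogeneous V cs ws"
  shows "linear_on (cscale V) (cscale V) (gr V b) (\<lambda>v. cscale V c (\<gamma> f (us @ v # ws)))"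
  using linear_onD[OF alg_multilinear[OF assms]]
  by (auto simp: linear_on_def vec.scale_right_distrib mult.commute)

lemma gamma_slot_zero:
  assumes "f \<in> component P n e" "length us + 1 + length ws = n"
    "homogeneous V as us" "homogeneous V cs ws"
  shows "\<gamma> f (us @ 0 # ws) = 0"
  using linear_on_zero[OF alg_multilinear[OF assms] vec.module_axioms subspace_gr[of 0]] .

lemma gamma_F:
  assumes "f \<in> component P (length vs) e" "list_all2 (\<lambda>(k, d) v. v \<in> F k d) kds vs"
  shows "\<gamma> f vs \<in> F (sum_list (map fst kds)) (e + sum_list (map snd kds))"
proof -
  have "length kds = length vs" using assms(2) by (rule list_all2_lengthD)
  moreover have "vs ! j \<in> F (map fst kds ! j) (map snd kds ! j)" if "j < length vs" for j
    using assms(2) that by (auto simp: list_all2_conv_all_nth case_prod_beta)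
  ultimately show ?thesis
    using compatible assms(1) unfolding compatible_filtration_def
    by (metis (no_types, lifting) length_map)
qed

lemma alpha_gr: "\<alpha> \<in> gr V 2"
  using F_gr[OF alpha_F] .

lemma homogeneous_alphas [intro]: "homogeneous V (replicate r 2) (replicate r \<alpha>)"
  by (induction r) (auto simp: alpha_gr)

lemma homogeneous_alphas_append [intro]:
  "homogeneous V ds vs \<Longrightarrow> homogeneous V (replicate r 2 @ ds) (replicate r \<alpha> @ vs)"
  by (intro list_all2_appendI homogeneous_alphas)

lemma gamma_F_slot:
  assumes "f \<in> component P (p + length us + 1 + length ws) e"
    "homogeneous V as us" "x \<in> F k b" "homogeneous V cs ws"
  shows "\<gamma> f (replicate p \<alpha> @ us @ x # ws) \<in> F (p + k) (e + 2 * int p + sum_list as + b + sum_list cs)"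
proof -
  let ?kds = "replicate p (1, 2) @ map (Pair 0) as @ (k, b) # map (Pair 0) cs"
  have "list_all2 (\<lambda>(k, d) v. v \<in> F k d) (replicate p (1, 2)) (replicate p \<alpha>)"
    using alpha_F by (induction p) auto
  then have "list_all2 (\<lambda>(k, d) v. v \<in> F k d) ?kds (replicate p \<alpha> @ us @ x # ws)"
    using assms by (intro list_all2_appendI) (auto simp: list_all2_map1 F_0)
  from gamma_F[where e = e, OF _ this] show ?thesis
    using assms(1) by (simp add: o_def sum_list_replicate add.assoc mult.commute)
qed

lemma gamma_F_alphas:
  assumes "f \<in> component P (p + length vs) e" "homogeneous V ds vs"
  shows "\<gamma> f (replicate p \<alpha> @ vs) \<in> F p (e + 2 * int p + sum_list ds)"
proof -
  let ?kds = "replicate p (1, 2) @ map (Pair 0) ds"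
  have "list_all2 (\<lambda>(k, d) v. v \<in> F k d) (replicate p (1, 2)) (replicate p \<alpha>)"
    using alpha_F by (induction p) auto
  then have "list_all2 (\<lambda>(k, d) v. v \<in> F k d) ?kds (replicate p \<alpha> @ vs)"
    using assms by (intro list_all2_appendI) (auto simp: list_all2_map1 F_0)
  from gamma_F[where e = e, OF _ this] show ?thesis
    using assms(1) by (simp add: o_def sum_list_replicate add.assoc mult.commute)
qed

text \<open>A relabelling in which every inversion involves an even argument contributes no sign, so only the
  sign of moving \<open>w\<close> past the arguments in front of it remains.\<close>

lemma labelled_ins_eval:
  assumes v: "v \<in> component P (length is + 1 + length ks) d" and w: "w \<in> component P (length js) e"
    and dist: "distinct (is @ js @ ks)" and set: "set (is @ js @ ks) = {1..length xs}"
    and xs: "homogeneous V ds xs"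
    and signs: "sorted_wrt (\<lambda>a b. b < a \<longrightarrow> even (entry ds a * entry ds b)) (is @ js @ ks)"
  shows "\<gamma> (labelled_ins P v is w js ks) xs = cscale V ((-1) powi (e * sum_list (map (entry ds) is)))
      (\<gamma> v (map (entry xs) is @ \<gamma> w (map (entry xs) js) # map (entry xs) ks))"
proof -
  let ?ls = "is @ js @ ks"
  have len: "length ?ls = length xs"
    using distinct_card[OF dist] set by simp
  have len_ds: "length ds = length xs" using xs by (rule list_all2_lengthD)
  have hom: "homogeneous V (map (entry ds) ls) (map (entry xs) ls)" if "set ls \<subseteq> set ?ls" for ls
    using list_all2_map_entry[OF xs] that set by auto
  have ins: "ins P (length is + 1 + length ks) (length is + 1) (length js) v w
      \<in> component P (length xs) (d + e)"
    using ins_closed[OF _ v w, of "length is + 1"] len by (simp add: add.commute add.left_commute)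
  have "\<gamma> (labelled_ins P v is w js ks) xs
      = cscale V (koszul_sign (list_perm ?ls) ds)
          (\<gamma> (ins P (length is + 1 + length ks) (length is + 1) (length js) v w) (permute (list_perm ?ls) xs))"
    using alg_act[OF ins _ refl xs, of "list_perm ?ls"] list_perm_permutes[OF dist] len set
    by (simp add: labelled_ins_def add.assoc)
  also have "\<dots> = \<gamma> (ins P (length is + 1 + length ks) (length is + 1) (length js) v w)
      (map (entry xs) is @ map (entry xs) js @ map (entry xs) ks)"
    using len len_ds by (simp add: permute_list_perm koszul_sign_list_perm[OF _ signs])
  also have "\<dots> = cscale V ((-1) powi (e * sum_list (map (entry ds) is)))
      (\<gamma> v (map (entry xs) is @ \<gamma> w (map (entry xs) js) # map (entry xs) ks))"
    using alg_ins[OF v w, of "map (entry xs) is" "map (entry xs) ks" "map (entry xs) js"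
        "map (entry ds) is" "map (entry ds) js" "map (entry ds) ks"]
      hom[of "is"] hom[of js] hom[of ks]
    by (simp add: le_supI2)
  finally show ?thesis .
qed

text \<open>If the labels beyond the first \<open>r\<close> occur in increasing order, then every inversion involves one
  of the first \<open>r\<close> arguments, and these are even.\<close>

lemma sorted_wrt_even_products:
  assumes "sorted_wrt (\<lambda>a b. r < b \<longrightarrow> a \<le> b) ls" "0 \<notin> set ls"
  shows "sorted_wrt (\<lambda>a b. b < a \<longrightarrow>
    even (entry (replicate r (2 :: int) @ ds) a * entry (replicate r 2 @ ds) b)) ls"
proof (rule sorted_wrt_mono_rel[OF _ assms(1)])
  fix a b assume "b \<in> set ls" "r < b \<longrightarrow> a \<le> b"
  then show "b < a \<longrightarrow> even (entry (replicate r (2 :: int) @ ds) a * entry (replicate r 2 @ ds) b)"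
    using assms(2) by (cases "b = 0") (auto simp: entry_def nth_append)
qed

end

lemma sorted_wrt_bounded:
  fixes r :: nat
  shows "set ls \<subseteq> {1..r} \<Longrightarrow> sorted_wrt (\<lambda>a b. r < b \<longrightarrow> a \<le> b) ls"
  by (induction ls) (fastforce simp: subset_iff)+

lemma sorted_wrt_upt_le: "sorted_wrt (\<lambda>a b. r < b \<longrightarrow> a \<le> b) [m..<n]"
  by (rule sorted_wrt_mono_rel[OF _ sorted_wrt_upt]) auto

lemma Sh_blocks:
  assumes "\<sigma> \<in> Sh p (r - p)" "p \<le> r"
  shows "set (map \<sigma> [1..<p + 1]) \<union> set (map \<sigma> [p + 1..<r + 1]) = {1..r}"
    and "set (map \<sigma> [1..<p + 1]) \<inter> set (map \<sigma> [p + 1..<r + 1]) = {}"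
    and "distinct (map \<sigma> [1..<p + 1])" "distinct (map \<sigma> [p + 1..<r + 1])"
proof -
  have \<sigma>: "\<sigma> permutes {1..r}" using assms by (simp add: Sh_def)
  have "{1..r} = {1..<p + 1} \<union> {p + 1..<r + 1}" using assms(2) by auto
  then show "set (map \<sigma> [1..<p + 1]) \<union> set (map \<sigma> [p + 1..<r + 1]) = {1..r}"
    using permutes_image[OF \<sigma>] by (simp add: image_Un[symmetric] del: upt_Suc)
  have "{1..<p + 1} \<inter> {p + 1..<r + 1} = {}" by auto
  then show "set (map \<sigma> [1..<p + 1]) \<inter> set (map \<sigma> [p + 1..<r + 1]) = {}"
    using permutes_inj[OF \<sigma>] by (simp add: image_Int[symmetric] del: upt_Suc)
  show "distinct (map \<sigma> [1..<p + 1])" "distinct (map \<sigma> [p + 1..<r + 1])"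
    using inj_on_subset[OF permutes_inj[OF \<sigma>]] by (simp_all add: distinct_map del: upt_Suc)
qed

context filtered_algebra
begin

text \<open>The ambient space of the twisted operad, before passing to invariants. The individual parts of
  the twisted differential are compared as elements of it.\<close>

definition family :: "nat \<Rightarrow> int \<Rightarrow> (nat \<Rightarrow> 'a) set" where
  "family n e = {f. \<forall>r. f r \<in> component P (r + n) (e - 2 * int r)}"

lemma familyD: "f \<in> family n e \<Longrightarrow> f r \<in> component P (r + n) (e - 2 * int r)"
  by (simp add: family_def)

text \<open>The value does not depend on the shuffle, so that a sum over shuffles becomes a binomial
  coefficient.\<close>

lemma tw_ins_term_eval:
  assumes f: "f \<in> family (length us + 1 + length ws) d" and g: "g \<in> family (length vs) e"
    and us: "homogeneous V as us" and vs: "homogeneous V bs vs" and ws: "homogeneous V cs ws"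
    and \<sigma>: "\<sigma> \<in> Sh p (r - p)" and pr: "p \<le> r"
    and n: "n = length us + 1 + length ws" and m: "m = length vs" and i: "i = length us + 1"
  shows "labelled_ins P (f p) (map \<sigma> [1..<p + 1] @ [r + 1..<r + i])
       (g (r - p)) (map \<sigma> [p + 1..<r + 1] @ [r + i..<r + i + m]) [r + i + m..<r + n + m]
     \<in> component P (r + (n + m - 1)) (d + e - 2 * int r)" (is ?closed)
    and "\<gamma> (labelled_ins P (f p) (map \<sigma> [1..<p + 1] @ [r + 1..<r + i])
       (g (r - p)) (map \<sigma> [p + 1..<r + 1] @ [r + i..<r + i + m])
       [r + i + m..<r + n + m]) (replicate r \<alpha> @ us @ vs @ ws)
     = cscale V ((-1) powi (e * sum_list as))
        (\<gamma> (f p) (replicate p \<alpha> @ us @ \<gamma> (g (r - p)) (replicate (r - p) \<alpha> @ vs) # ws))" (is ?eval)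
proof -
  define A where "A = map \<sigma> [1..<p + 1]"
  define B where "B = map \<sigma> [p + 1..<r + 1]"
  define U where "U = [r + 1..<r + i]"
  define W where "W = [r + i..<r + i + m]"
  define K where "K = [r + i + m..<r + n + m]"
  note defs = A_def[symmetric] B_def[symmetric] U_def[symmetric] W_def[symmetric] K_def[symmetric]
  let ?xs = "replicate r \<alpha> @ us @ vs @ ws" and ?ds = "replicate r (2 :: int) @ as @ bs @ cs"
  note blocks = Sh_blocks[OF \<sigma> pr, folded A_def B_def]
  have AB: "set A \<subseteq> {1..r}" "set B \<subseteq> {1..r}" using blocks(1) by blast+
  have lens: "length A = p" "length B = r - p" "length U = length us" "length W = length vs"
    "length K = length ws"
    using pr by (simp_all add: A_def B_def U_def W_def K_def n m i del: upt_Suc)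
  have sets: "set U = {r + 1..<r + i}" "set W = {r + i..<r + i + m}" "set K = {r + i + m..<r + n + m}"
    and dists: "distinct U" "distinct W" "distinct K"
    by (simp_all add: U_def W_def K_def del: upt_Suc)
  have v: "f p \<in> component P (length (A @ U) + 1 + length K) (d - 2 * int p)"
    using familyD[OF f, of p] by (simp add: lens add.assoc)
  have w: "g (r - p) \<in> component P (length (B @ W)) (e - 2 * int (r - p))"
    using familyD[OF g, of "r - p"] by (simp add: lens)
  have dist: "distinct ((A @ U) @ (B @ W) @ K)"
    using blocks(2-4) AB dists by (auto simp: sets i)
  have "set ((A @ U) @ (B @ W) @ K) = (set A \<union> set B) \<union> (set U \<union> set W \<union> set K)"
    by auto
  also have "\<dots> = {1..length ?xs}" unfolding blocks(1) sets by (auto simp: n m i)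
  finally have set: "set ((A @ U) @ (B @ W) @ K) = {1..length ?xs}" .
  have len: "length (A @ U) + length (B @ W) + length K = r + (n + m - 1)"
    using pr by (simp add: lens n m)
  have len': "length ((A @ U) @ (B @ W) @ K) = r + (n + m - 1)" "length ?xs = r + (n + m - 1)"
    using pr by (simp_all add: lens n m)
  have deg: "d - 2 * int p + (e - 2 * int (r - p)) = d + e - 2 * int r"
    using pr by (simp add: of_nat_diff)
  have "ins P (length (A @ U) + 1 + length K) (length (A @ U) + 1) (length (B @ W)) (f p) (g (r - p))
      \<in> component P (r + (n + m - 1)) (d + e - 2 * int r)"
    using ins_closed[OF _ v w, of "length (A @ U) + 1"] pr unfolding deg by (simp add: lens n m ac_simps)
  moreover have "list_perm ((A @ U) @ (B @ W) @ K) permutes {1..r + (n + m - 1)}"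
    using list_perm_permutes[OF dist] set len' by simp
  ultimately show ?closed
    unfolding labelled_ins_def defs len by (rule act_closed[rotated])
  have signs: "sorted_wrt (\<lambda>a b. b < a \<longrightarrow> even (entry ?ds a * entry ?ds b)) ((A @ U) @ (B @ W) @ K)"
  proof (rule sorted_wrt_even_products)
    show "0 \<notin> set ((A @ U) @ (B @ W) @ K)" unfolding set by simp
    have "sorted_wrt (\<lambda>a b. r < b \<longrightarrow> a \<le> b) L" if "L \<in> {U, W, K}" for L
      using that sorted_wrt_upt_le by (auto simp: U_def W_def K_def simp del: upt_Suc)
    then show "sorted_wrt (\<lambda>a b. r < b \<longrightarrow> a \<le> b) ((A @ U) @ (B @ W) @ K)"
      using sorted_wrt_bounded[OF AB(1)] sorted_wrt_bounded[OF AB(2)] AB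
      by (fastforce simp: sorted_wrt_append sets)
  qed
  have hom: "homogeneous V ?ds ?xs"
    using us vs ws by (intro homogeneous_alphas_append list_all2_appendI)
  have las: "length as = length us" using us by (rule list_all2_lengthD)
  have eA: "map (entry ?xs) A = replicate p \<alpha>" "map (entry ?ds) A = replicate p 2"
    and eB: "map (entry ?xs) B = replicate (r - p) \<alpha>"
    using AB lens(1,2) by (simp_all add: map_entry_const)
  have eU: "map (entry ?xs) U = us" "map (entry ?ds) U = as"
    unfolding U_def using las by (simp_all add: map_entry_upt i del: upt_Suc)
  have eW: "map (entry ?xs) W = vs"
    using map_entry_upt[of "replicate r \<alpha> @ us" "r + i" vs "r + i + m" ws] by (simp add: i m W_def)
  have eK: "map (entry ?xs) K = ws"
    using map_entry_upt[of "replicate r \<alpha> @ us @ vs" "r + i + m" ws "r + n + m" "[]"]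
    by (simp add: n i m K_def)
  have "((-1) :: 'k) powi ((e - 2 * int (r - p)) * sum_list (map (entry ?ds) (A @ U)))
      = (-1) powi (e * sum_list as)"
    by (rule neg_one_powi_cong) (simp add: eA eU sum_list_replicate algebra_simps)
  with labelled_ins_eval[OF v w dist set hom signs] show ?eval
    unfolding defs by (simp add: eA eB eU eW eK)
qed

end

context filtered_algebra
begin

lemma binomial_over_fact:
  assumes "p \<le> r"
  shows "1 / fact r * of_nat (r choose p) = (1 / (fact p * fact (r - p)) :: 'k)"
  using binomial_fact[OF assms, where ?'a = 'k] by simp

lemma tw_ins_eval:
  assumes f: "f \<in> family (length us + 1 + length ws) d" and g: "g \<in> family (length vs) e"
    and us: "homogeneous V as us" and vs: "homogeneous V bs vs" and ws: "homogeneous V cs ws"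
    and n: "n = length us + 1 + length ws" and m: "m = length vs" and i: "i = length us + 1"
  shows "\<gamma> (tw_ins P n i m f g r) (replicate r \<alpha> @ us @ vs @ ws)
     = (\<Sum>p\<le>r. cscale V (of_nat (r choose p) * (-1) powi (e * sum_list as))
        (\<gamma> (f p) (replicate p \<alpha> @ us @ \<gamma> (g (r - p)) (replicate (r - p) \<alpha> @ vs) # ws)))"
    (is "_ = (\<Sum>p\<le>r. cscale V (_ * ?s) (?t p))")
    and "tw_ins P n i m f g \<in> family (n + m - 1) (d + e)"
proof -
  let ?x = "\<lambda>r p \<sigma>. labelled_ins P (f p) (map \<sigma> [1..<p + 1] @ [r + 1..<r + i])
       (g (r - p)) (map \<sigma> [p + 1..<r + 1] @ [r + i..<r + i + m]) [r + i + m..<r + n + m]"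
  note term_eval = tw_ins_term_eval[OF f g us vs ws _ _ n m i]
  show "tw_ins P n i m f g \<in> family (n + m - 1) (d + e)"
    unfolding family_def tw_ins_def using term_eval(1) by (auto intro!: component_sum)
  have hom: "homogeneous V (replicate r 2 @ as @ bs @ cs) (replicate r \<alpha> @ us @ vs @ ws)"
    using us vs ws by (intro homogeneous_alphas_append list_all2_appendI)
  have len: "length (replicate r \<alpha> @ us @ vs @ ws) = r + (n + m - 1)"
    by (simp add: n m)
  have closed: "?x r p \<sigma> \<in> component P (length (replicate r \<alpha> @ us @ vs @ ws)) (d + e - 2 * int r)"
    if "\<sigma> \<in> Sh p (r - p)" "p \<in> {0..r}" for p \<sigma>
    using term_eval(1)[OF that(1)] that(2) unfolding len by simp
  have "\<gamma> (tw_ins P n i m f g r) (replicate r \<alpha> @ us @ vs @ ws)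
      = (\<Sum>p = 0..r. \<gamma> (\<Sum>\<sigma>\<in>Sh p (r - p). ?x r p \<sigma>) (replicate r \<alpha> @ us @ vs @ ws))"
    unfolding tw_ins_def by (rule gamma_sum[OF _ hom]) (rule component_sum, rule closed)
  also have "\<dots> = (\<Sum>p = 0..r. \<Sum>\<sigma>\<in>Sh p (r - p). \<gamma> (?x r p \<sigma>) (replicate r \<alpha> @ us @ vs @ ws))"
    by (intro sum.cong refl gamma_sum[OF _ hom]) (rule closed)
  also have "\<dots> = (\<Sum>p = 0..r. \<Sum>\<sigma>\<in>Sh p (r - p). cscale V ?s (?t p))"
    by (intro sum.cong refl term_eval(2)) auto
  also have "\<dots> = (\<Sum>p = 0..r. cscale V (of_nat (r choose p) * ?s) (?t p))"
    by (intro sum.cong refl) (simp add: vec.sum_constant_scale card_Sh)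
  finally show "\<gamma> (tw_ins P n i m f g r) (replicate r \<alpha> @ us @ vs @ ws)
      = (\<Sum>p\<le>r. cscale V (of_nat (r choose p) * ?s) (?t p))"
    by (simp add: atLeast0AtMost)
qed

lemma tw_terms_F:
  assumes "f \<in> family (length vs) e" "homogeneous V ds vs"
  shows "tw_terms V \<gamma> \<alpha> f vs r \<in> F r (e + sum_list ds)"
  using gamma_F_alphas[OF familyD[OF assms(1)] assms(2)]
  by (auto simp: tw_terms_def intro: F_scale)

lemma tw_action_series:
  assumes "f \<in> family (length vs) e" "homogeneous V ds vs"
  shows "series (e + sum_list ds) (tw_terms V \<gamma> \<alpha> f vs) (tw_action V \<gamma> F \<alpha> f vs)"
  unfolding tw_action_def by (rule series_filt_suminf) (rule tw_terms_F[OF assms])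

lemma tw_action_eqI:
  assumes "series c (tw_terms V \<gamma> \<alpha> f vs) y"
  shows "tw_action V \<gamma> F \<alpha> f vs = y"
  unfolding tw_action_def by (rule filt_suminf_eq[OF assms])

lemma tw_action_closed:
  assumes "f \<in> family (length vs) e" "homogeneous V ds vs"
  shows "tw_action V \<gamma> F \<alpha> f vs \<in> gr V (e + sum_list ds)"
  using seriesD(3)[OF tw_action_series[OF assms]] .

text \<open>The action of a composite is the double series obtained by substituting the series of \<open>g\<close> into
  each term of the series of \<open>f\<close>, summed along diagonals: multiplying \<open>1 / r!\<close> by the number of
  shuffles gives the product of the coefficients of the two series.\<close>

lemma tw_action_ins:
  assumes f: "f \<in> family (length us + 1 + length ws) d" and g: "g \<in> family (length vs) e"
    and us: "homogeneous V as us" and vs: "homogeneous V bs vs" and ws: "homogeneous V cs ws"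
    and n: "n = length us + 1 + length ws" and m: "m = length vs" and i: "i = length us + 1"
  shows "tw_action V \<gamma> F \<alpha> (tw_ins P n i m f g) (us @ vs @ ws)
    = cscale V ((-1) powi (e * sum_list as))
        (tw_action V \<gamma> F \<alpha> f (us @ tw_action V \<gamma> F \<alpha> g vs # ws))" (is "_ = cscale V ?s ?y")
proof (rule tw_action_eqI)
  let ?b = "e + sum_list bs" and ?G = "tw_action V \<gamma> F \<alpha> g vs"
  let ?c = "d + sum_list as + ?b + sum_list cs"
  let ?h = "\<lambda>p v. cscale V (1 / fact p) (\<gamma> (f p) (replicate p \<alpha> @ us @ v # ws))"
  let ?x = "\<lambda>p q. ?h p (tw_terms V \<gamma> \<alpha> g vs q)"
  have G: "series ?b (tw_terms V \<gamma> \<alpha> g vs) ?G" by (rule tw_action_series[OF g vs])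
  have fp: "f p \<in> component P (p + length us + 1 + length ws) (d - 2 * int p)" for p
    using familyD[OF f, of p] by (simp add: add.assoc)
  have h_lin: "linear_on (cscale V) (cscale V) (gr V ?b) (?h p)" for p
    using gamma_slot_linear[OF fp _ homogeneous_alphas_append[OF us] ws] by simp
  have h_F: "?h p v \<in> F (k + p) ?c" if "v \<in> F k ?b" for p k v
    using gamma_F_slot[OF fp[of p] us that ws] by (intro F_scale) (simp add: add.commute[of k p])
  have "series ?c (tw_terms V \<gamma> \<alpha> f (us @ ?G # ws)) ?y"
    using tw_action_series[of f "us @ ?G # ws" d "as @ ?b # cs"] f us ws seriesD(3)[OF G]
    by (simp add: list_all2_appendI add.assoc)
  moreover have "tw_terms V \<gamma> \<alpha> f (us @ ?G # ws) = (\<lambda>p. ?h p ?G)"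
    by (simp add: tw_terms_def)
  ultimately have "series ?c (\<lambda>p. ?h p ?G) ?y" by simp
  then have "series ?c (\<lambda>r. \<Sum>p\<le>r. ?x p (r - p)) ?y"
  proof (rule series_diagonal)
    show "?x p q \<in> F (p + q) ?c" for p q
      using h_F[OF seriesD(1)[OF G]] by (simp add: add.commute)
    show "?h p ?G - (\<Sum>q<M. ?x p q) \<in> F (p + M) ?c" for p M
      unfolding add.commute[of p M] by (rule series_map_remainder[OF h_lin h_F G])
  qed
  then have "series ?c (\<lambda>r. cscale V ?s (\<Sum>p\<le>r. ?x p (r - p))) (cscale V ?s ?y)"
    by (rule series_scale)
  moreover have "tw_terms V \<gamma> \<alpha> (tw_ins P n i m f g) (us @ vs @ ws)
      = (\<lambda>r. cscale V ?s (\<Sum>p\<le>r. ?x p (r - p)))"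
  proof
    fix r
    have "?x p (r - p) = cscale V (1 / fact r * of_nat (r choose p))
        (\<gamma> (f p) (replicate p \<alpha> @ us @ \<gamma> (g (r - p)) (replicate (r - p) \<alpha> @ vs) # ws))"
      if "p \<le> r" for p
    proof -
      have "\<gamma> (g (r - p)) (replicate (r - p) \<alpha> @ vs) \<in> gr V ?b"
        using F_gr[OF gamma_F_alphas[OF familyD[OF g] vs]] by simp
      then have "?h p (cscale V c (\<gamma> (g (r - p)) (replicate (r - p) \<alpha> @ vs)))
          = cscale V c (?h p (\<gamma> (g (r - p)) (replicate (r - p) \<alpha> @ vs)))" for c
        by (rule linear_onD(2)[OF h_lin])
      then show ?thesis
        unfolding tw_terms_def binomial_over_fact[OF that] by (simp add: mult.commute)
    qed
    then show "tw_terms V \<gamma> \<alpha> (tw_ins P n i m f g) (us @ vs @ ws) r = cscale V ?s (\<Sum>p\<le>r. ?x p (r - p))"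
      unfolding tw_terms_def tw_ins_eval(1)[OF assms]
      by (simp add: vec.scale_sum_right mult.commute mult.left_commute)
  qed
  ultimately show "series ?c (tw_terms V \<gamma> \<alpha> (tw_ins P n i m f g) (us @ vs @ ws)) (cscale V ?s ?y)"
    by simp
qed

text \<open>For an operation invariant under its first \<open>r\<close> inputs, exchange the two positions by a
  transposition; it passes \<open>x\<close> only over even elements and thus causes no sign.\<close>

lemma gamma_move_to_front:
  assumes f: "f \<in> component P (r + length vs) e"
    and inv: "\<And>\<tau>. \<tau> permutes {1..r} \<Longrightarrow> act P (r + length vs) \<tau> f = f"
    and x: "x \<in> gr V b" and vs: "homogeneous V ds vs" and i: "i < r"
  shows "\<gamma> f (replicate i \<alpha> @ x # replicate (r - Suc i) \<alpha> @ vs) = \<gamma> f (x # replicate (r - 1) \<alpha> @ vs)"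
proof -
  let ?\<tau> = "transpose 1 (Suc i)"
  let ?xs = "replicate i \<alpha> @ x # replicate (r - Suc i) \<alpha> @ vs"
  let ?ds = "replicate i 2 @ b # replicate (r - Suc i) 2 @ ds"
  have perm: "?\<tau> permutes {1..r}" using i by (intro permutes_swap_id) auto
  then have perm': "?\<tau> permutes {1..r + length vs}" by (rule permutes_subset) auto
  have hom: "homogeneous V ?ds ?xs"
    using x homogeneous_alphas_append[OF vs] by (intro list_all2_appendI homogeneous_alphas) simp
  have len: "length ?xs = r + length vs" "length ?ds = r + length vs"
    using i list_all2_lengthD[OF vs] by simp_all
  have "koszul_sign ?\<tau> ?ds = (1 :: 'k)"
  proof (rule koszul_sign_eq_1)
    fix k l assume kl: "1 \<le> k" "k < l" "l \<le> length ?ds" "?\<tau> l < ?\<tau> k"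
    have l: "l \<le> r"
      using kl i by (auto simp: transpose_def split: if_splits)
    have two: "?ds ! (j - 1) = 2" if "j \<in> {1..r}" "j \<noteq> Suc i" for j
      using that by (auto simp: nth_append nth_Cons split: nat.splits)
    have "?\<tau> k \<in> {1..r}" "?\<tau> l \<in> {1..r}"
      unfolding permutes_in_image[OF perm] using kl(1,2) l by simp_all
    moreover have "?\<tau> k \<noteq> Suc i \<or> ?\<tau> l \<noteq> Suc i" using kl(4) by auto
    ultimately show "even (?ds ! (?\<tau> k - 1) * ?ds ! (?\<tau> l - 1))"
      using two by fastforce
  qed
  moreover have "permute ?\<tau> ?xs = x # replicate (r - 1) \<alpha> @ vs"
  proof (rule nth_equalityI)
    fix k assume "k < length (permute ?\<tau> ?xs)"
    then show "permute ?\<tau> ?xs ! k = (x # replicate (r - 1) \<alpha> @ vs) ! k"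
      using i by (auto simp: nth_permute transpose_def nth_append nth_Cons split: nat.splits
          intro!: arg_cong[of _ _ "(!) vs"])
  qed (use i in auto)
  ultimately show ?thesis
    using alg_act[OF f perm' len(1) hom] inv[OF perm] by simp
qed

end

section \<open>The differential of the twisted operad\<close>

lemma sum_lessThan_add:
  fixes g :: "nat \<Rightarrow> 'b::comm_monoid_add"
  shows "(\<Sum>i<r + n. g i) = (\<Sum>i<r. g i) + (\<Sum>i<n. g (r + i))"
  by (induction n) (simp_all add: add.assoc)

text \<open>Of the morphism from the operad of homotopy Lie algebras only the images \<open>\<phi>\<^sub>n\<close> of the generators
  matter. With \<open>\<phi>\<^sub>0 = \<phi>\<^sub>1 = 0\<close> the formulas hold for all indices, and the Maurer--Cartan equation is
  a statement about a series over all \<open>n\<close>.\<close>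

locale twisting = filtered_algebra P V \<gamma> F \<alpha>
  for P :: "('k::field_char_0, 'a::ab_group_add, 'z) dg_operad_struct_scheme"
    and V :: "('k, 'v::ab_group_add) complex_struct"
    and \<gamma> :: "'a \<Rightarrow> 'v list \<Rightarrow> 'v"
    and F :: "nat \<Rightarrow> int \<Rightarrow> 'v set"
    and \<alpha> :: 'v +
  fixes \<phi> :: "nat \<Rightarrow> 'a"
  assumes phi_closed: "\<phi> n \<in> component P n (3 - 2 * int n)"
    and phi_invariant: "\<sigma> permutes {1..n} \<Longrightarrow> act P n \<sigma> (\<phi> n) = \<phi> n"
    and phi_eq_0: "n < 2 \<Longrightarrow> \<phi> n = 0"
    and odiff_phi: "odiff P n (3 - 2 * int n) (\<phi> n) =
      - (\<Sum>p = 2..n - 1. \<Sum>\<sigma>\<in>Sh p (n - p).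
          act P n \<sigma> (ins P (n - p + 1) 1 p (\<phi> (n - p + 1)) (\<phi> p)))"
    and maurer_cartan_series:
      "series 3 (\<lambda>n. cscale V (1 / fact n) (\<gamma> (\<phi> n) (replicate n \<alpha>))) (- cdiff V \<alpha>)"
begin

text \<open>The second summand of the twisted differential, up to sign.\<close>

definition insert_brackets :: "nat \<Rightarrow> (nat \<Rightarrow> 'a) \<Rightarrow> nat \<Rightarrow> 'a" where
  "insert_brackets n f = (\<lambda>r. \<Sum>p = 1..r. \<Sum>\<sigma>\<in>Sh p (r - p).
     labelled_ins P (f (r - p + 1)) [] (\<phi> p) (map \<sigma> [1..<p + 1])
       (map \<sigma> [p + 1..<r + 1] @ [r + 1..<r + n + 1]))"

lemma phi_alphas_gr: "\<gamma> (\<phi> p) (replicate p \<alpha>) \<in> gr V 3"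
  using F_gr[OF gamma_F_alphas[of "\<phi> p" p "[]" "3 - 2 * int p" "[]"]] phi_closed[of p] by simp

lemma insert_brackets_term_eval:
  assumes f: "f \<in> family n e" and vs: "homogeneous V ds vs" and n: "n = length vs"
    and \<sigma>: "\<sigma> \<in> Sh p (r - p)" and pr: "p \<in> {1..r}"
  shows "labelled_ins P (f (r - p + 1)) [] (\<phi> p) (map \<sigma> [1..<p + 1])
       (map \<sigma> [p + 1..<r + 1] @ [r + 1..<r + n + 1]) \<in> component P (r + n) (e + 1 - 2 * int r)"
      (is ?closed)
    and "\<gamma> (labelled_ins P (f (r - p + 1)) [] (\<phi> p) (map \<sigma> [1..<p + 1])
       (map \<sigma> [p + 1..<r + 1] @ [r + 1..<r + n + 1])) (replicate r \<alpha> @ vs)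
      = \<gamma> (f (r - p + 1)) (\<gamma> (\<phi> p) (replicate p \<alpha>) # replicate (r - p) \<alpha> @ vs)" (is ?eval)
proof -
  define A where "A = map \<sigma> [1..<p + 1]"
  define B where "B = map \<sigma> [p + 1..<r + 1]"
  define U where "U = [r + 1..<r + n + 1]"
  note defs = A_def[symmetric] B_def[symmetric] U_def[symmetric]
  have pr': "p \<le> r" using pr by simp
  let ?xs = "replicate r \<alpha> @ vs" and ?ds = "replicate r (2 :: int) @ ds"
  note blocks = Sh_blocks[OF \<sigma> pr', folded A_def B_def]
  have AB: "set A \<subseteq> {1..r}" "set B \<subseteq> {1..r}" using blocks(1) by blast+
  have lens: "length A = p" "length B = r - p" "length U = length vs"
    using pr by (simp_all add: A_def B_def U_def n del: upt_Suc)
  have sets: "set U = {r + 1..<r + n + 1}" and dists: "distinct U"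
    by (simp_all add: U_def del: upt_Suc)
  have deg: "e - 2 * int (r - p + 1) + (3 - 2 * int p) = e + 1 - 2 * int r"
    using pr' by (simp add: of_nat_diff)
  have v: "f (r - p + 1) \<in> component P (length [] + 1 + length (B @ U)) (e - 2 * int (r - p + 1))"
    using familyD[OF f, of "r - p + 1"] by (simp add: lens n)
  have w: "\<phi> p \<in> component P (length A) (3 - 2 * int p)"
    using phi_closed[of p] by (simp add: lens)
  have dist: "distinct ([] @ A @ B @ U)"
    using blocks(2-4) AB dists by (auto simp: sets)
  have "set ([] @ A @ B @ U) = (set A \<union> set B) \<union> set U" by auto
  also have "\<dots> = {1..length ?xs}" unfolding blocks(1) sets by (auto simp: n)
  finally have set: "set ([] @ A @ B @ U) = {1..length ?xs}" .
  have len: "length [] + length A + length (B @ U) = r + n"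
    using pr by (simp add: lens n)
  have len': "length ([] @ A @ B @ U) = r + n" "length ?xs = r + n"
    using pr by (simp_all add: lens n)
  have "ins P (length [] + 1 + length (B @ U)) (length [] + 1) (length A) (f (r - p + 1)) (\<phi> p)
      \<in> component P (r + n) (e + 1 - 2 * int r)"
    using ins_closed[OF _ v w, of 1] pr unfolding deg by (simp add: lens n ac_simps)
  moreover have "list_perm ([] @ A @ B @ U) permutes {1..r + n}"
    using list_perm_permutes[OF dist] set len' by simp
  ultimately show ?closed
    unfolding labelled_ins_def defs len by (rule act_closed[rotated])
  have signs: "sorted_wrt (\<lambda>a b. b < a \<longrightarrow> even (entry ?ds a * entry ?ds b)) ([] @ A @ B @ U)"
  proof (rule sorted_wrt_even_products)
    show "0 \<notin> set ([] @ A @ B @ U)" unfolding set by simp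
    have "sorted_wrt (\<lambda>a b. r < b \<longrightarrow> a \<le> b) U"
      using sorted_wrt_upt_le by (simp add: U_def del: upt_Suc)
    then show "sorted_wrt (\<lambda>a b. r < b \<longrightarrow> a \<le> b) ([] @ A @ B @ U)"
      using sorted_wrt_bounded[OF AB(1)] sorted_wrt_bounded[OF AB(2)] AB
      by (fastforce simp: sorted_wrt_append sets)
  qed
  have hom: "homogeneous V ?ds ?xs" using vs by (intro homogeneous_alphas_append)
  have eAB: "map (entry ?xs) A = replicate p \<alpha>" "map (entry ?xs) B = replicate (r - p) \<alpha>"
    using AB lens(1,2) by (simp_all add: map_entry_const)
  have eU: "map (entry ?xs) U = vs"
    using map_entry_upt[of "replicate r \<alpha>" "r + 1" vs "r + n + 1" "[]"] by (simp add: U_def n del: upt_Suc)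
  from labelled_ins_eval[OF v w dist set hom signs] show ?eval
    unfolding defs by (simp add: eAB eU)
qed

lemma insert_brackets_eval:
  assumes f: "f \<in> family n e" and vs: "homogeneous V ds vs" and n: "n = length vs"
  shows "\<gamma> (insert_brackets n f r) (replicate r \<alpha> @ vs) = (\<Sum>p = 1..r. cscale V (of_nat (r choose p))
      (\<gamma> (f (r - p + 1)) (\<gamma> (\<phi> p) (replicate p \<alpha>) # replicate (r - p) \<alpha> @ vs)))"
proof -
  let ?x = "\<lambda>p \<sigma>. labelled_ins P (f (r - p + 1)) [] (\<phi> p) (map \<sigma> [1..<p + 1])
       (map \<sigma> [p + 1..<r + 1] @ [r + 1..<r + n + 1])"
  note term_eval = insert_brackets_term_eval[OF f vs n]
  have hom: "homogeneous V (replicate r 2 @ ds) (replicate r \<alpha> @ vs)"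
    using vs by (rule homogeneous_alphas_append)
  have closed: "?x p \<sigma> \<in> component P (length (replicate r \<alpha> @ vs)) (e + 1 - 2 * int r)"
    if "\<sigma> \<in> Sh p (r - p)" "p \<in> {1..r}" for p \<sigma>
    using term_eval(1)[OF that] by (simp add: n)
  have "\<gamma> (insert_brackets n f r) (replicate r \<alpha> @ vs)
      = (\<Sum>p = 1..r. \<gamma> (\<Sum>\<sigma>\<in>Sh p (r - p). ?x p \<sigma>) (replicate r \<alpha> @ vs))"
    unfolding insert_brackets_def by (rule gamma_sum[OF _ hom]) (rule component_sum, rule closed)
  also have "\<dots> = (\<Sum>p = 1..r. \<Sum>\<sigma>\<in>Sh p (r - p). \<gamma> (?x p \<sigma>) (replicate r \<alpha> @ vs))"
    by (intro sum.cong refl gamma_sum[OF _ hom]) (rule closed)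
  also have "\<dots> = (\<Sum>p = 1..r. \<Sum>\<sigma>\<in>Sh p (r - p).
      \<gamma> (f (r - p + 1)) (\<gamma> (\<phi> p) (replicate p \<alpha>) # replicate (r - p) \<alpha> @ vs))"
    by (intro sum.cong refl term_eval(2))
  finally show ?thesis
    by (auto simp: vec.sum_constant_scale card_Sh intro!: sum.cong)
qed

lemma insert_brackets_family:
  assumes "f \<in> family n e" "homogeneous V ds vs" "n = length vs"
  shows "insert_brackets n f \<in> family n (e + 1)"
  unfolding family_def insert_brackets_def
  using insert_brackets_term_eval(1)[OF assms] by (auto intro!: component_sum)

text \<open>The Maurer--Cartan equation expands \<open>- \<partial>\<alpha>\<close> into a series of brackets, and substituting this series
  term by term gives a double series, whose diagonal sums are the shuffle sums of inserted brackets.\<close>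

lemma tw_action_insert_brackets:
  assumes f: "f \<in> family n e" and vs: "homogeneous V ds vs" and n: "n = length vs"
    and Y: "series (e + 1 + sum_list ds)
      (\<lambda>p. cscale V (1 / fact p) (\<gamma> (f (Suc p)) (cdiff V \<alpha> # replicate p \<alpha> @ vs))) Y"
  shows "tw_action V \<gamma> F \<alpha> (insert_brackets n f) vs = - Y"
proof (rule tw_action_eqI)
  let ?c = "e + 1 + sum_list ds"
  let ?h = "\<lambda>p v. cscale V (1 / fact p) (\<gamma> (f (Suc p)) (v # replicate p \<alpha> @ vs))"
  let ?m = "\<lambda>q. cscale V (1 / fact q) (\<gamma> (\<phi> q) (replicate q \<alpha>))"
  have hom: "homogeneous V (replicate p 2 @ ds) (replicate p \<alpha> @ vs)" for p
    using vs by (rule homogeneous_alphas_append)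
  have fp: "f (Suc p) \<in> component P (length [] + 1 + length (replicate p \<alpha> @ vs)) (e - 2 * int (Suc p))" for p
    using familyD[OF f, of "Suc p"] by (simp add: n)
  have h_lin: "linear_on (cscale V) (cscale V) (gr V 3) (?h p)" for p
    using gamma_slot_linear[OF fp refl list_all2_Nil[THEN iffD2] hom] by simp
  have h_F: "?h p v \<in> F (k + p) ?c" if "v \<in> F k 3" for p k v
  proof (rule F_scale)
    have "list_all2 (\<lambda>(k, d) v. v \<in> F k d) (replicate p (1, 2)) (replicate p \<alpha>)"
      using alpha_F by (induction p) auto
    then have "list_all2 (\<lambda>(k, d) v. v \<in> F k d) ((k, 3) # replicate p (1, 2) @ map (Pair 0) ds)
        (v # replicate p \<alpha> @ vs)"
      using that vs by (simp add: list_all2_appendI list_all2_map1 F_0)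
    from gamma_F[where e = "e - 2 * int (Suc p)", OF _ this]
    show "\<gamma> (f (Suc p)) (v # replicate p \<alpha> @ vs) \<in> F (k + p) ?c"
      using fp[of p] by (simp add: o_def sum_list_replicate algebra_simps)
  qed
  have neg: "?h p (- cdiff V \<alpha>) = - ?h p (cdiff V \<alpha>)" for p
    using linear_on_neg[OF h_lin vec.module_axioms subspace_gr] cdiff_closed[OF alpha_gr] by simp
  have "series ?c (\<lambda>p. ?h p (- cdiff V \<alpha>)) (- Y)"
    unfolding neg using series_neg[OF Y] .
  then have "series ?c (\<lambda>r. \<Sum>p\<le>r. ?h p (?m (r - p))) (- Y)"
  proof (rule series_diagonal)
    show "?h p (?m q) \<in> F (p + q) ?c" for p q
      unfolding add.commute[of p q] by (rule h_F) (rule seriesD(1)[OF maurer_cartan_series])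
    show "?h p (- cdiff V \<alpha>) - (\<Sum>q<M. ?h p (?m q)) \<in> F (p + M) ?c" for p M
      unfolding add.commute[of p M] by (rule series_map_remainder[OF h_lin h_F maurer_cartan_series])
  qed
  moreover have "tw_terms V \<gamma> \<alpha> (insert_brackets n f) vs = (\<lambda>r. \<Sum>p\<le>r. ?h p (?m (r - p)))"
  proof
    fix r
    let ?t = "\<lambda>p. \<gamma> (f (r - p + 1)) (\<gamma> (\<phi> p) (replicate p \<alpha>) # replicate (r - p) \<alpha> @ vs)"
    have h_m: "?h (r - p) (?m p) = cscale V (1 / fact r * of_nat (r choose p)) (?t p)" if "p \<le> r" for p
    proof -
      have "?h (r - p) (?m p) = cscale V (1 / fact p) (?h (r - p) (\<gamma> (\<phi> p) (replicate p \<alpha>)))"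
        by (rule linear_onD(2)[OF h_lin phi_alphas_gr])
      then show ?thesis unfolding binomial_over_fact[OF that] by simp
    qed
    have t0: "?t 0 = 0"
      using gamma_slot_zero[OF fp refl list_all2_Nil[THEN iffD2] hom] by (simp add: phi_eq_0)
    have "tw_terms V \<gamma> \<alpha> (insert_brackets n f) vs r
        = (\<Sum>p = 1..r. cscale V (1 / fact r * of_nat (r choose p)) (?t p))"
      unfolding tw_terms_def insert_brackets_eval[OF f vs n] by (simp add: vec.scale_sum_right)
    also have "\<dots> = (\<Sum>p\<le>r. cscale V (1 / fact r * of_nat (r choose p)) (?t p))"
      using t0 by (intro sum.mono_neutral_left) (auto simp: Suc_le_eq)
    also have "\<dots> = (\<Sum>p\<le>r. ?h (r - p) (?m p))"
      by (intro sum.cong refl h_m[symmetric]) simp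
    also have "\<dots> = (\<Sum>p\<le>r. ?h p (?m (r - p)))"
      by (rule sum.reindex_bij_witness[where i = "\<lambda>p. r - p" and j = "\<lambda>p. r - p"]) auto
    finally show "tw_terms V \<gamma> \<alpha> (insert_brackets n f) vs r = (\<Sum>p\<le>r. ?h p (?m (r - p)))" .
  qed
  ultimately show "series ?c (tw_terms V \<gamma> \<alpha> (insert_brackets n f) vs) (- Y)"
    by simp
qed

lemma Tw_component_iff:
  "f \<in> component (Tw P \<psi>) n e \<longleftrightarrow> f \<in> family n e \<and>
    (\<forall>r \<tau>. \<tau> permutes {1..r} \<longrightarrow> act P (r + n) \<tau> (f r) = f r)"
  by (auto simp: Tw_def family_def)

definition diff_family :: "nat \<Rightarrow> int \<Rightarrow> (nat \<Rightarrow> 'a) \<Rightarrow> nat \<Rightarrow> 'a" where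
  "diff_family n e f = (\<lambda>r. odiff P (r + n) (e - 2 * int r) (f r))"

lemma diff_family_family: "f \<in> family n e \<Longrightarrow> diff_family n e f \<in> family n (e + 1)"
  using odiff_closed[OF familyD[of f n e]] unfolding family_def diff_family_def
  by (auto simp: add_diff_eq[symmetric] add.commute)

text \<open>The Leibniz rule of \<open>V\<close>, with the \<open>r\<close> terms that differentiate a copy of \<open>\<alpha>\<close> collected into one.\<close>

lemma cdiff_gamma_alphas:
  assumes f: "f \<in> component (Tw P \<psi>) n e" and vs: "homogeneous V ds vs" and n: "n = length vs"
  shows "cdiff V (\<gamma> (f r) (replicate r \<alpha> @ vs)) = \<gamma> (diff_family n e f r) (replicate r \<alpha> @ vs)
    + cscale V ((-1) powi e) (cscale V (of_nat r) (\<gamma> (f r) (cdiff V \<alpha> # replicate (r - 1) \<alpha> @ vs))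
      + (\<Sum>i<n. cscale V ((-1) powi sum_list (take i ds)) (\<gamma> (f r) (replicate r \<alpha> @ vs[i := cdiff V (vs ! i)]))))"
proof -
  let ?xs = "replicate r \<alpha> @ vs" and ?ds = "replicate r (2::int) @ ds"
  let ?t = "\<lambda>i. cscale V ((-1) powi sum_list (take i ?ds)) (\<gamma> (f r) (?xs[i := cdiff V (?xs ! i)]))"
  have fr: "f r \<in> component P (r + length vs) (e - 2 * int r)"
    using f familyD by (auto simp: Tw_component_iff n)
  have inv: "\<tau> permutes {1..r} \<Longrightarrow> act P (r + length vs) \<tau> (f r) = f r" for \<tau>
    using f by (simp add: Tw_component_iff n)
  have "(\<Sum>i<r. ?t i) = (\<Sum>i<r. \<gamma> (f r) (cdiff V \<alpha> # replicate (r - 1) \<alpha> @ vs))"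
  proof (rule sum.cong[OF refl])
    fix i assume "i \<in> {..<r}"
    then have i: "i < r" by simp
    have "replicate r \<alpha> = replicate i \<alpha> @ \<alpha> # replicate (r - Suc i) \<alpha>"
      using i by (simp add: replicate_Suc[symmetric] replicate_add[symmetric] del: replicate_Suc)
    then have "?xs[i := cdiff V (?xs ! i)] = replicate i \<alpha> @ cdiff V \<alpha> # replicate (r - Suc i) \<alpha> @ vs"
      by (simp add: list_update_append nth_append)
    moreover have "((-1) :: 'k) powi sum_list (take i ?ds) = 1"
      using i by (simp add: sum_list_replicate power_int_minus_left)
    ultimately show "?t i = \<gamma> (f r) (cdiff V \<alpha> # replicate (r - 1) \<alpha> @ vs)"
      using gamma_move_to_front[OF fr inv cdiff_closed[OF alpha_gr] vs i] by simp
  qed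
  moreover have "?t (r + i) = cscale V ((-1) powi sum_list (take i ds))
      (\<gamma> (f r) (replicate r \<alpha> @ vs[i := cdiff V (vs ! i)]))" for i
  proof -
    have "((-1) :: 'k) powi sum_list (take (r + i) ?ds) = (-1) powi sum_list (take i ds)"
      by (rule neg_one_powi_cong) (simp add: sum_list_replicate)
    then show ?thesis by (simp add: list_update_append nth_append)
  qed
  moreover have "((-1) :: 'k) powi (e - 2 * int r) = (-1) powi e"
    by (rule neg_one_powi_cong) simp
  ultimately show ?thesis
    using alg_diff[OF fr _ homogeneous_alphas_append[OF vs]]
    by (simp add: sum_lessThan_add vec.sum_constant_scale diff_family_def n)
qed

lemma cdiff_F: "v \<in> F k d \<Longrightarrow> cdiff V v \<in> F k (d + 1)"
  using compatible by (auto simp: compatible_filtration_def)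

lemma homogeneous_update_cdiff:
  assumes "homogeneous V ds vs" "i < length vs"
  shows "homogeneous V (ds[i := ds ! i + 1]) (vs[i := cdiff V (vs ! i)])"
  using assms by (intro list_all2_update_cong) (auto simp: list_all2_conv_all_nth cdiff_closed)

lemma sum_list_update_plus_1: "i < length ds \<Longrightarrow> sum_list (ds[i := ds ! i + (1::int)]) = sum_list ds + 1"
  by (induction ds arbitrary: i) (auto split: nat.splits)

text \<open>The Leibniz rule summed over \<open>r\<close>. In the terms with \<open>\<partial>\<alpha>\<close> the factor \<open>r / r!\<close> cancels to
  \<open>1 / (r - 1)!\<close>, which shifts the index of their series by one.\<close>

lemma cdiff_tw_action:
  assumes f: "f \<in> component (Tw P \<psi>) n e" and vs: "homogeneous V ds vs" and n: "n = length vs"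
  shows "cdiff V (tw_action V \<gamma> F \<alpha> f vs) = tw_action V \<gamma> F \<alpha> (diff_family n e f) vs
    + cscale V ((-1) powi e) (- tw_action V \<gamma> F \<alpha> (insert_brackets n f) vs
      + (\<Sum>i<n. cscale V ((-1) powi sum_list (take i ds)) (tw_action V \<gamma> F \<alpha> f (vs[i := cdiff V (vs ! i)]))))"
proof -
  let ?c = "e + 1 + sum_list ds"
  let ?A = "\<lambda>p. cscale V (1 / fact p) (\<gamma> (f (Suc p)) (cdiff V \<alpha> # replicate p \<alpha> @ vs))"
  let ?B = "\<lambda>r. case r of 0 \<Rightarrow> 0 | Suc r \<Rightarrow> ?A r"
  let ?v = "\<lambda>i. vs[i := cdiff V (vs ! i)]"
  have fam: "f \<in> family n e" using f by (simp add: Tw_component_iff)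
  have fam': "f \<in> family (length vs) e" using fam n by simp
  have A_F: "?A p \<in> F (Suc p) ?c" for p
  proof (rule F_scale)
    have "list_all2 (\<lambda>(k, d) v. v \<in> F k d) (replicate p (1, 2)) (replicate p \<alpha>)"
      using alpha_F by (induction p) auto
    then have "list_all2 (\<lambda>(k, d) v. v \<in> F k d) ((1, 3) # replicate p (1, 2) @ map (Pair 0) ds)
        (cdiff V \<alpha> # replicate p \<alpha> @ vs)"
      using cdiff_F[OF alpha_F] vs by (simp add: list_all2_appendI list_all2_map1 F_0)
    from gamma_F[where e = "e - 2 * int (Suc p)", OF _ this]
    show "\<gamma> (f (Suc p)) (cdiff V \<alpha> # replicate p \<alpha> @ vs) \<in> F (Suc p) ?c"
      using familyD[OF fam, of "Suc p"] by (simp add: n o_def sum_list_replicate algebra_simps)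
  qed
  obtain Y where Y: "series ?c ?A Y"
    using series_exists[of ?A ?c] A_F F_antimono by (metis le_SucI order_refl)
  have Y_eq: "Y = - tw_action V \<gamma> F \<alpha> (insert_brackets n f) vs"
    using tw_action_insert_brackets[OF fam vs n Y] by simp
  have "series (e + sum_list ds + 1) (\<lambda>r. cdiff V (tw_terms V \<gamma> \<alpha> f vs r)) (cdiff V (tw_action V \<gamma> F \<alpha> f vs))"
    by (rule series_map[OF cdiff_linear cdiff_F tw_action_series[OF fam' vs]])
  moreover have "series ?c (\<lambda>r. tw_terms V \<gamma> \<alpha> (diff_family n e f) vs r + cscale V ((-1) powi e)
        (?B r + (\<Sum>i<n. cscale V ((-1) powi sum_list (take i ds)) (tw_terms V \<gamma> \<alpha> f (?v i) r))))
      (tw_action V \<gamma> F \<alpha> (diff_family n e f) vs + cscale V ((-1) powi e)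
        (Y + (\<Sum>i<n. cscale V ((-1) powi sum_list (take i ds)) (tw_action V \<gamma> F \<alpha> f (?v i)))))"
  proof (intro series_add series_scale series_sum)
    show "series ?c (tw_terms V \<gamma> \<alpha> (diff_family n e f) vs) (tw_action V \<gamma> F \<alpha> (diff_family n e f) vs)"
      by (rule tw_action_series[OF _ vs]) (use diff_family_family[OF fam] n in simp)
    show "series ?c ?B Y" by (rule series_shift[OF Y A_F])
    fix i assume "i \<in> {..<n}"
    then have i: "i < length vs" "i < length ds" using n list_all2_lengthD[OF vs] by auto
    show "series ?c (tw_terms V \<gamma> \<alpha> f (?v i)) (tw_action V \<gamma> F \<alpha> f (?v i))"
      using tw_action_series[of f "?v i", OF _ homogeneous_update_cdiff[OF vs i(1)], of e] fam'
      by (simp add: sum_list_update_plus_1[OF i(2)] add.assoc add.commute[of 1])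
  qed
  moreover have "cdiff V (tw_terms V \<gamma> \<alpha> f vs r) = tw_terms V \<gamma> \<alpha> (diff_family n e f) vs r
      + cscale V ((-1) powi e)
        (?B r + (\<Sum>i<n. cscale V ((-1) powi sum_list (take i ds)) (tw_terms V \<gamma> \<alpha> f (?v i) r)))" for r
  proof -
    have "\<gamma> (f r) (replicate r \<alpha> @ vs) \<in> gr V (e + sum_list ds)"
      using F_gr[OF gamma_F_alphas[OF familyD[OF fam'] vs]] by simp
    then have "cdiff V (tw_terms V \<gamma> \<alpha> f vs r) = cscale V (1 / fact r) (cdiff V (\<gamma> (f r) (replicate r \<alpha> @ vs)))"
      unfolding tw_terms_def by (rule linear_onD(2)[OF cdiff_linear])
    moreover have "?B r = cscale V (of_nat r / fact r) (\<gamma> (f r) (cdiff V \<alpha> # replicate (r - 1) \<alpha> @ vs))"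
      by (cases r) (simp_all add: field_simps del: of_nat_Suc)
    ultimately show ?thesis
      unfolding cdiff_gamma_alphas[OF f vs n] tw_terms_def
      by (simp add: vec.scale_right_distrib vec.scale_sum_right vec.scale_left_commute)
  qed
  ultimately show ?thesis
    unfolding Y_eq by (simp add: ac_simps series_unique)
qed

end

lemma sum_fun_apply: "(\<Sum>i\<in>I. g i) x = (\<Sum>i\<in>I. g i x)"
  for g :: "'i \<Rightarrow> 'b \<Rightarrow> 'c::comm_monoid_add"
  by (induction I rule: infinite_finite_induct) auto

context filtered_algebra
begin

lemma tw_action_linear:
  assumes vs: "homogeneous V ds vs" and n: "length vs = n"
  shows "linear_on (\<lambda>c f r. oscale P c (f r)) (cscale V) (family n e) (\<lambda>f. tw_action V \<gamma> F \<alpha> f vs)"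
  unfolding linear_on_def
proof (intro conjI ballI allI)
  have lin: "linear_on (oscale P) (cscale V) (component P (r + n) (e - 2 * int r)) (\<lambda>f. \<gamma> f (replicate r \<alpha> @ vs))" for r
    using alg_linear[OF _ homogeneous_alphas_append[OF vs]] n by simp
  fix f assume "f \<in> family n e"
  then have f: "f \<in> family (length vs) e" by (simp add: n)
  note fS = tw_action_series[OF f vs]
  {
    fix g assume "g \<in> family n e"
    then have g: "g \<in> family (length vs) e" by (simp add: n)
    have "tw_terms V \<gamma> \<alpha> (f + g) vs = (\<lambda>r. tw_terms V \<gamma> \<alpha> f vs r + tw_terms V \<gamma> \<alpha> g vs r)"
      using linear_onD(1)[OF lin] familyD[OF f] familyD[OF g]
      by (simp add: tw_terms_def fun_eq_iff n vec.scale_right_distrib)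
    then show "tw_action V \<gamma> F \<alpha> (f + g) vs = tw_action V \<gamma> F \<alpha> f vs + tw_action V \<gamma> F \<alpha> g vs"
      using series_add[OF fS tw_action_series[OF g vs]] by (intro tw_action_eqI) simp
  next
    fix c
    have "tw_terms V \<gamma> \<alpha> (\<lambda>r. oscale P c (f r)) vs = (\<lambda>r. cscale V c (tw_terms V \<gamma> \<alpha> f vs r))"
      using linear_onD(2)[OF lin] familyD[OF f]
      by (simp add: tw_terms_def fun_eq_iff n mult.commute)
    then show "tw_action V \<gamma> F \<alpha> (\<lambda>r. oscale P c (f r)) vs = cscale V c (tw_action V \<gamma> F \<alpha> f vs)"
      using series_scale[OF fS] by (intro tw_action_eqI) simp
  }
qed

lemma tw_action_slot_linear:
  assumes f: "f \<in> family n e" and n: "length us + 1 + length ws = n"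
    and us: "homogeneous V as us" and ws: "homogeneous V cs ws"
  shows "linear_on (cscale V) (cscale V) (gr V b) (\<lambda>v. tw_action V \<gamma> F \<alpha> f (us @ v # ws))"
  unfolding linear_on_def
proof (intro conjI ballI allI)
  have lin: "linear_on (cscale V) (cscale V) (gr V b) (\<lambda>v. tw_terms V \<gamma> \<alpha> f (us @ v # ws) r)" for r
    using gamma_slot_linear[OF familyD[OF f, of r] _ homogeneous_alphas_append[OF us] ws] n
    by (simp add: tw_terms_def)
  have S: "series (e + sum_list (as @ b # cs)) (tw_terms V \<gamma> \<alpha> f (us @ v # ws)) (tw_action V \<gamma> F \<alpha> f (us @ v # ws))"
    if "v \<in> gr V b" for v
    using f n us ws that by (intro tw_action_series list_all2_appendI) auto
  fix x assume x: "x \<in> gr V b"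
  {
    fix y assume y: "y \<in> gr V b"
    have "tw_terms V \<gamma> \<alpha> f (us @ (x + y) # ws)
        = (\<lambda>r. tw_terms V \<gamma> \<alpha> f (us @ x # ws) r + tw_terms V \<gamma> \<alpha> f (us @ y # ws) r)"
      using linear_onD(1)[OF lin x y] by blast
    then show "tw_action V \<gamma> F \<alpha> f (us @ (x + y) # ws)
        = tw_action V \<gamma> F \<alpha> f (us @ x # ws) + tw_action V \<gamma> F \<alpha> f (us @ y # ws)"
      using series_add[OF S[OF x] S[OF y]] by (intro tw_action_eqI) simp
  next
    fix c
    have "tw_terms V \<gamma> \<alpha> f (us @ cscale V c x # ws) = (\<lambda>r. cscale V c (tw_terms V \<gamma> \<alpha> f (us @ x # ws) r))"
      using linear_onD(2)[OF lin x] by blast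
    then show "tw_action V \<gamma> F \<alpha> f (us @ cscale V c x # ws) = cscale V c (tw_action V \<gamma> F \<alpha> f (us @ x # ws))"
      using series_scale[OF S[OF x]] by (intro tw_action_eqI) simp
  }
qed

lemma module_families: "module (\<lambda>c f (r::nat). oscale P c (f r))"
  by unfold_locales (auto simp: fun_eq_iff op.scale_right_distrib op.scale_left_distrib)

lemma subspace_family: "module.subspace (\<lambda>c f (r::nat). oscale P c (f r)) (family n e)"
  unfolding module.subspace_def[OF module_families] family_def
  by (auto intro: component_add component_scale)

end

context twisting
begin

abbreviation \<kappa> :: "nat \<Rightarrow> 'a" where
  "\<kappa> \<equiv> \<lambda>r. \<phi> (r + 1)"

abbreviation action :: "(nat \<Rightarrow> 'a) \<Rightarrow> 'v list \<Rightarrow> 'v" where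
  "action \<equiv> tw_action V \<gamma> F \<alpha>"

lemma kappa_Tw: "\<kappa> \<in> component (Tw P \<psi>) 1 1"
  unfolding Tw_component_iff family_def
proof (intro conjI CollectI allI impI)
  show "\<phi> (r + 1) \<in> component P (r + 1) (1 - 2 * int r)" for r
    using phi_closed[of "r + 1"] by (simp add: algebra_simps)
  fix r \<tau> assume "\<tau> permutes {1..r::nat}"
  then have "\<tau> permutes {1..r + 1}" by (rule permutes_subset) auto
  then show "act P (r + 1) \<tau> (\<phi> (r + 1)) = \<phi> (r + 1)" by (rule phi_invariant)
qed

lemma kappa_family: "\<kappa> \<in> family 1 1"
  using kappa_Tw by (simp add: Tw_component_iff)

text \<open>In a bracket of brackets evaluated on formal arguments and one further argument \<open>v\<close>, only the
  position of \<open>v\<close> matters, that is, which block of the shuffle contains the largest letter.\<close>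

lemma bracket_term_eval:
  assumes v: "v \<in> gr V d" and p: "p \<in> {2..r}" and \<sigma>: "\<sigma> \<in> Sh p (Suc r - p)"
  shows "act P (Suc r) \<sigma> (ins P (Suc r - p + 1) 1 p (\<phi> (Suc r - p + 1)) (\<phi> p))
      \<in> component P (Suc r) (2 - 2 * int r)" (is ?closed)
    and "\<gamma> (act P (Suc r) \<sigma> (ins P (Suc r - p + 1) 1 p (\<phi> (Suc r - p + 1)) (\<phi> p))) (replicate r \<alpha> @ [v])
      = (if Suc r \<in> \<sigma> ` {1..p}
         then \<gamma> (\<phi> (Suc r - p + 1)) (\<gamma> (\<phi> p) (replicate (p - 1) \<alpha> @ [v]) # replicate (Suc r - p) \<alpha>)
         else \<gamma> (\<phi> (Suc r - p + 1)) (\<gamma> (\<phi> p) (replicate p \<alpha>) # replicate (r - p) \<alpha> @ [v]))" (is ?eval)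
proof -
  let ?xs = "replicate r \<alpha> @ [v]" and ?ds = "replicate r 2 @ [d]"
  define m where "m = Suc r - p + 1"
  have pr: "p \<le> r" "2 \<le> p" using p by auto
  have perm: "\<sigma> permutes {1..Suc r}" using \<sigma> pr by (simp add: Sh_def)
  have ins: "ins P m 1 p (\<phi> m) (\<phi> p) \<in> component P (Suc r) (2 - 2 * int r)"
  proof -
    have deg: "3 - 2 * int m + (3 - 2 * int p) = 2 - 2 * int r"
      using pr by (simp add: of_nat_diff m_def)
    have "m + p - 1 = Suc r" "1 \<in> {1..m}" using pr by (simp_all add: m_def)
    then show ?thesis
      using ins_closed[OF _ phi_closed[of m] phi_closed[of p], of 1] unfolding deg by simp
  qed
  then show ?closed unfolding m_def by (rule act_closed[OF perm])
  have hom: "homogeneous V ?ds ?xs" using v by (intro homogeneous_alphas_append) simp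
  have inj: "\<sigma> i = \<sigma> j \<longleftrightarrow> i = j" for i j using permutes_inj[OF perm] by (rule inj_eq)
  have "koszul_sign \<sigma> ?ds = (1 :: 'k)"
  proof (rule koszul_sign_eq_1)
    fix i j assume ij: "1 \<le> i" "i < j" "j \<le> length ?ds" "\<sigma> j < \<sigma> i"
    \<comment> \<open>Only the larger one of two labels can be the label of \<open>v\<close>.\<close>
    have "\<sigma> j \<in> {1..Suc r}" "\<sigma> i \<in> {1..Suc r}"
      unfolding permutes_in_image[OF perm] using ij(1-3) by auto
    then have "?ds ! (\<sigma> j - 1) = 2" using ij(4) by (auto simp: nth_append)
    then show "even (?ds ! (\<sigma> i - 1) * ?ds ! (\<sigma> j - 1))" by simp
  qed
  then have eval: "\<gamma> (act P (Suc r) \<sigma> (ins P m 1 p (\<phi> m) (\<phi> p))) ?xs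
      = \<gamma> (ins P m 1 p (\<phi> m) (\<phi> p)) (permute \<sigma> ?xs)"
    using alg_act[OF ins perm _ hom] by simp
  have nth: "permute \<sigma> ?xs ! k = (if Suc k = j then v else \<alpha>)" if "\<sigma> j = Suc r" "k < Suc r" for j k
  proof -
    have "\<sigma> (Suc k) \<in> {1..Suc r}" unfolding permutes_in_image[OF perm] using that by simp
    moreover have "\<sigma> (Suc k) = Suc r \<longleftrightarrow> Suc k = j" using inj that(1) by metis
    ultimately show ?thesis using that(2) by (auto simp: nth_permute nth_append)
  qed
  show ?eval
  proof (cases "Suc r \<in> \<sigma> ` {1..p}")
    case True
    have \<sigma>p: "\<sigma> p = Suc r" using Sh_last_in_first[OF \<sigma> _ True] pr by simp
    have "permute \<sigma> ?xs = [] @ (replicate (p - 1) \<alpha> @ [v]) @ replicate (Suc r - p) \<alpha>"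
    proof (rule nth_equalityI)
      fix k assume "k < length (permute \<sigma> ?xs)"
      then show "permute \<sigma> ?xs ! k = ([] @ (replicate (p - 1) \<alpha> @ [v]) @ replicate (Suc r - p) \<alpha>) ! k"
        using pr nth[OF \<sigma>p, of k] by (auto simp: nth_append nth_Cons')
    qed (use pr in auto)
    moreover have "\<gamma> (ins P m 1 p (\<phi> m) (\<phi> p)) ([] @ (replicate (p - 1) \<alpha> @ [v]) @ replicate (Suc r - p) \<alpha>)
        = \<gamma> (\<phi> m) (\<gamma> (\<phi> p) (replicate (p - 1) \<alpha> @ [v]) # replicate (Suc r - p) \<alpha>)"
      using alg_ins[OF phi_closed[of m] phi_closed[of p], of "[]" "replicate (Suc r - p) \<alpha>"
          "replicate (p - 1) \<alpha> @ [v]" "[]" "replicate (p - 1) 2 @ [d]" "replicate (Suc r - p) 2"]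
        homogeneous_alphas_append[of "[d]" "[v]" "p - 1"] homogeneous_alphas[of "Suc r - p"] v pr
      by (simp add: m_def)
    ultimately show ?thesis using True eval by (simp add: m_def)
  next
    case False
    have \<sigma>r: "\<sigma> (Suc r) = Suc r" using Sh_last_in_second[OF \<sigma> _ False] pr by simp
    have "permute \<sigma> ?xs = [] @ replicate p \<alpha> @ (replicate (r - p) \<alpha> @ [v])"
    proof (rule nth_equalityI)
      fix k assume "k < length (permute \<sigma> ?xs)"
      then show "permute \<sigma> ?xs ! k = ([] @ replicate p \<alpha> @ (replicate (r - p) \<alpha> @ [v])) ! k"
        using pr nth[OF \<sigma>r, of k] by (auto simp: nth_append nth_Cons')
    qed (use pr in auto)
    moreover have "\<gamma> (ins P m 1 p (\<phi> m) (\<phi> p)) ([] @ replicate p \<alpha> @ (replicate (r - p) \<alpha> @ [v]))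
        = \<gamma> (\<phi> m) (\<gamma> (\<phi> p) (replicate p \<alpha>) # replicate (r - p) \<alpha> @ [v])"
      using alg_ins[OF phi_closed[of m] phi_closed[of p], of "[]" "replicate (r - p) \<alpha> @ [v]"
          "replicate p \<alpha>" "[]" "replicate p 2" "replicate (r - p) 2 @ [d]"]
        homogeneous_alphas_append[of "[d]" "[v]" "r - p"] homogeneous_alphas[of p] v pr
      by (simp add: m_def Suc_diff_le)
    ultimately show ?thesis using False eval by (simp add: m_def)
  qed
qed

text \<open>The relation that makes \<open>\<partial>\<^sup>\<alpha>\<close> square to zero: the twisted differential of \<open>\<kappa>\<close> is
  \<open>\<kappa> \<circ>\<^sub>1 \<kappa>\<close>. It suffices to have it evaluated on copies of \<open>\<alpha>\<close> and one element \<open>v\<close>. The shuffles with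
  \<open>v\<close> in the outer bracket (the terms \<open>?X\<close>) cancel the inserted brackets, those with \<open>v\<close> in the
  inner bracket (the terms \<open>?Y\<close>) cancel \<open>\<kappa> \<circ>\<^sub>1 \<kappa>\<close>.\<close>

lemma kappa_relation_terms:
  assumes v: "v \<in> gr V d"
  shows "\<gamma> (diff_family 1 1 \<kappa> r) (replicate r \<alpha> @ [v]) + \<gamma> (insert_brackets 1 \<kappa> r) (replicate r \<alpha> @ [v])
    + \<gamma> (tw_ins P 1 1 1 \<kappa> \<kappa> r) (replicate r \<alpha> @ [v]) = 0"
proof -
  let ?xs = "replicate r \<alpha> @ [v]"
  let ?X = "\<lambda>p. \<gamma> (\<phi> (Suc r - p + 1)) (\<gamma> (\<phi> p) (replicate p \<alpha>) # replicate (r - p) \<alpha> @ [v])"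
  let ?Y = "\<lambda>p. \<gamma> (\<phi> (Suc r - p + 1)) (\<gamma> (\<phi> p) (replicate (p - 1) \<alpha> @ [v]) # replicate (Suc r - p) \<alpha>)"
  let ?t = "\<lambda>p \<sigma>. act P (Suc r) \<sigma> (ins P (Suc r - p + 1) 1 p (\<phi> (Suc r - p + 1)) (\<phi> p))"
  have v': "homogeneous V [d] [v]" using v by simp
  have hom: "homogeneous V (replicate q 2 @ [d]) (replicate q \<alpha> @ [v])" for q
    using v' by (rule homogeneous_alphas_append)
  have closed: "?t p \<sigma> \<in> component P (length ?xs) (2 - 2 * int r)"
    if "p \<in> {2..r}" "\<sigma> \<in> Sh p (Suc r - p)" for p \<sigma>
    using bracket_term_eval(1)[OF v that] by simp
  have shuffles: "(\<Sum>\<sigma>\<in>Sh p (Suc r - p). if Suc r \<in> \<sigma> ` {1..p} then ?Y p else ?X p)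
      = cscale V (of_nat (r choose (p - 1))) (?Y p) + cscale V (of_nat (r choose p)) (?X p)"
    if "p \<in> {2..r}" for p
  proof -
    have "(\<Sum>\<sigma>\<in>Sh p (Suc r - p). if Suc r \<in> \<sigma> ` {1..p} then ?Y p else ?X p)
      = (\<Sum>\<sigma>\<in>Sh p (Suc r - p) \<inter> {\<sigma>. Suc r \<in> \<sigma> ` {1..p}}. ?Y p)
        + (\<Sum>\<sigma>\<in>Sh p (Suc r - p) \<inter> - {\<sigma>. Suc r \<in> \<sigma> ` {1..p}}. ?X p)"
      by (rule sum.If_cases) simp
    moreover have "Sh p (Suc r - p) \<inter> {\<sigma>. Suc r \<in> \<sigma> ` {1..p}} = {\<sigma> \<in> Sh p (Suc r - p). Suc r \<in> \<sigma> ` {1..p}}"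
      "Sh p (Suc r - p) \<inter> - {\<sigma>. Suc r \<in> \<sigma> ` {1..p}} = {\<sigma> \<in> Sh p (Suc r - p). Suc r \<notin> \<sigma> ` {1..p}}"
      by auto
    moreover have "1 \<le> p" "p \<le> r" using that by auto
    ultimately show ?thesis
      by (simp only: vec.sum_constant_scale card_Sh_last_in_first card_Sh_last_in_second)
  qed
  have "diff_family 1 1 \<kappa> r = odiff P (Suc r) (3 - 2 * int (Suc r)) (\<phi> (Suc r))"
    by (simp add: diff_family_def)
  also have "\<dots> = - (\<Sum>p = 2..r. \<Sum>\<sigma>\<in>Sh p (Suc r - p). ?t p \<sigma>)"
    unfolding odiff_phi by simp
  finally have "\<gamma> (diff_family 1 1 \<kappa> r) ?xs = \<gamma> (- (\<Sum>p = 2..r. \<Sum>\<sigma>\<in>Sh p (Suc r - p). ?t p \<sigma>)) ?xs"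
    by simp
  also have "\<dots> = - \<gamma> (\<Sum>p = 2..r. \<Sum>\<sigma>\<in>Sh p (Suc r - p). ?t p \<sigma>) ?xs"
    by (rule gamma_neg[where e = "2 - 2 * int r", OF _ hom]) (intro component_sum closed)
  also have "\<gamma> (\<Sum>p = 2..r. \<Sum>\<sigma>\<in>Sh p (Suc r - p). ?t p \<sigma>) ?xs
      = (\<Sum>p = 2..r. \<gamma> (\<Sum>\<sigma>\<in>Sh p (Suc r - p). ?t p \<sigma>) ?xs)"
    by (rule gamma_sum[where e = "2 - 2 * int r", OF _ hom]) (intro component_sum closed)
  also have "\<dots> = (\<Sum>p = 2..r. \<Sum>\<sigma>\<in>Sh p (Suc r - p). \<gamma> (?t p \<sigma>) ?xs)"
    by (intro sum.cong refl gamma_sum[where e = "2 - 2 * int r", OF _ hom] closed)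
  also have "\<dots> = (\<Sum>p = 2..r. \<Sum>\<sigma>\<in>Sh p (Suc r - p). if Suc r \<in> \<sigma> ` {1..p} then ?Y p else ?X p)"
    by (intro sum.cong refl bracket_term_eval(2)[OF v])
  also have "\<dots> = (\<Sum>p = 2..r. cscale V (of_nat (r choose (p - 1))) (?Y p) + cscale V (of_nat (r choose p)) (?X p))"
    by (intro sum.cong refl shuffles)
  finally have diff: "\<gamma> (diff_family 1 1 \<kappa> r) ?xs =
      - (\<Sum>p = 2..r. cscale V (of_nat (r choose (p - 1))) (?Y p))
      - (\<Sum>p = 2..r. cscale V (of_nat (r choose p)) (?X p))"
    by (simp add: sum.distrib)
  have "\<gamma> (insert_brackets 1 \<kappa> r) ?xs = (\<Sum>p = 1..r. cscale V (of_nat (r choose p)) (?X p))"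
    using insert_brackets_eval[OF kappa_family v', of r] by (simp add: Suc_diff_le)
  also have "\<dots> = (\<Sum>p = 2..r. cscale V (of_nat (r choose p)) (?X p))"
  proof (rule sum.mono_neutral_right)
    have "?X 1 = 0" if "1 \<le> r"
      using gamma_slot_zero[OF phi_closed[of "Suc r"] _ list_all2_Nil[THEN iffD2] hom[of "r - 1"]]
        gamma_zero[of "[2]" "[\<alpha>]"] alpha_gr that
      by (simp add: phi_eq_0)
    moreover have "p = 1" if "p \<in> {1..r} - {2..r}" for p using that by auto
    ultimately show "\<forall>p\<in>{1..r} - {2..r}. cscale V (of_nat (r choose p)) (?X p) = 0"
      by fastforce
  qed auto
  finally have brackets: "\<gamma> (insert_brackets 1 \<kappa> r) ?xs = (\<Sum>p = 2..r. cscale V (of_nat (r choose p)) (?X p))" .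
  have inner_gr: "\<gamma> (\<phi> (Suc q)) (replicate q \<alpha> @ [v]) \<in> gr V (1 + d)" for q
    using F_gr[OF gamma_F_alphas[OF _ v', of "\<phi> (Suc q)" q "3 - 2 * int (Suc q)"]] phi_closed[of "Suc q"]
    by simp
  have "\<gamma> (tw_ins P 1 1 1 \<kappa> \<kappa> r) ?xs = (\<Sum>p\<le>r. cscale V (of_nat (r choose p))
      (\<gamma> (\<phi> (Suc p)) (replicate p \<alpha> @ [\<gamma> (\<phi> (Suc (r - p))) (replicate (r - p) \<alpha> @ [v])])))"
    using tw_ins_eval(1)[of \<kappa> "[]" "[]" 1 \<kappa> "[v]" 1 "[]" "[d]" "[]" 1 1 1 r] kappa_family v by simp
  also have "\<dots> = (\<Sum>q = 1..Suc r. cscale V (of_nat (r choose (q - 1))) (?Y q))"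
  proof (rule sum.reindex_bij_witness[where i = "\<lambda>q. Suc r - q" and j = "\<lambda>p. Suc r - p"])
    fix p assume p: "p \<in> {..r}"
    have "\<gamma> (\<phi> (Suc p)) (replicate p \<alpha> @ [\<gamma> (\<phi> (Suc (r - p))) (replicate (r - p) \<alpha> @ [v])])
        = \<gamma> (\<phi> (Suc p)) (\<gamma> (\<phi> (Suc (r - p))) (replicate (r - p) \<alpha> @ [v]) # replicate p \<alpha>)"
      using gamma_move_to_front[where r = "Suc p" and i = p and vs = "[]" and ds = "[]", OF _ _ inner_gr]
        phi_closed[of "Suc p"] phi_invariant[of _ "Suc p"] by simp
    moreover have "r choose (r - p) = r choose p" using p binomial_symmetric[of p r] by simp
    ultimately show "cscale V (of_nat (r choose (Suc r - p - 1))) (?Y (Suc r - p)) = cscale V (of_nat (r choose p))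
      (\<gamma> (\<phi> (Suc p)) (replicate p \<alpha> @ [\<gamma> (\<phi> (Suc (r - p))) (replicate (r - p) \<alpha> @ [v])]))"
      using p by (simp add: Suc_diff_le)
  qed auto
  also have "\<dots> = (\<Sum>q = 2..r. cscale V (of_nat (r choose (q - 1))) (?Y q))"
  proof (rule sum.mono_neutral_right)
    have "?Y 1 = 0"
      using gamma_slot_zero[OF phi_closed[of "Suc r"] _ list_all2_Nil[THEN iffD2] homogeneous_alphas[of r]]
        gamma_zero[OF v'] by (simp add: phi_eq_0)
    moreover have "?Y (Suc r) = 0"
      using inner_gr[of r] gamma_zero[of "[1 + d]" "[\<gamma> (\<phi> (Suc r)) (replicate r \<alpha> @ [v])]"] by (simp add: phi_eq_0)
    moreover have "q = 1 \<or> q = Suc r" if "q \<in> {1..Suc r} - {2..r}" for q using that by auto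
    ultimately show "\<forall>q\<in>{1..Suc r} - {2..r}. cscale V (of_nat (r choose (q - 1))) (?Y q) = 0"
      by (metis vec.scale_zero_right)
  qed auto
  finally show ?thesis unfolding diff brackets by simp
qed


lemma kappa_relation:
  assumes v: "v \<in> gr V d"
  shows "action (diff_family 1 1 \<kappa>) [v] + action (insert_brackets 1 \<kappa>) [v] + action \<kappa> [action \<kappa> [v]] = 0"
proof -
  have v': "homogeneous V [d] [v]" using v by simp
  have ins: "tw_ins P 1 1 1 \<kappa> \<kappa> \<in> family (length [v]) 2"
    using tw_ins_eval(2)[of \<kappa> "[]" "[]" 1 \<kappa> "[v]" 1 "[]" "[d]" "[]" 1 1 1] kappa_family v by simp
  have "series (2 + sum_list [d]) (\<lambda>r. tw_terms V \<gamma> \<alpha> (diff_family 1 1 \<kappa>) [v] r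
        + tw_terms V \<gamma> \<alpha> (insert_brackets 1 \<kappa>) [v] r + tw_terms V \<gamma> \<alpha> (tw_ins P 1 1 1 \<kappa> \<kappa>) [v] r)
      (action (diff_family 1 1 \<kappa>) [v] + action (insert_brackets 1 \<kappa>) [v] + action (tw_ins P 1 1 1 \<kappa> \<kappa>) [v])"
    using diff_family_family[OF kappa_family] insert_brackets_family[OF kappa_family v'] ins
    by (intro series_add tw_action_series v') simp_all
  moreover have "tw_terms V \<gamma> \<alpha> (diff_family 1 1 \<kappa>) [v] r
        + tw_terms V \<gamma> \<alpha> (insert_brackets 1 \<kappa>) [v] r + tw_terms V \<gamma> \<alpha> (tw_ins P 1 1 1 \<kappa> \<kappa>) [v] r = 0" for r
    using kappa_relation_terms[OF v, of r]
    by (simp only: tw_terms_def vec.scale_right_distrib[symmetric] vec.scale_zero_right)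
  ultimately have "action (diff_family 1 1 \<kappa>) [v] + action (insert_brackets 1 \<kappa>) [v]
      + action (tw_ins P 1 1 1 \<kappa> \<kappa>) [v] = 0"
    using series_unique[OF _ series_zero] by simp
  then show ?thesis
    using tw_action_ins[of \<kappa> "[]" "[]" 1 \<kappa> "[v]" 1 "[]" "[d]" "[]" 1 1 1] kappa_family v by simp
qed

section \<open>The twisted algebra\<close>

abbreviation twisted :: "('k, 'v) complex_struct" where
  "twisted \<equiv> twisted_complex V \<gamma> \<phi> F \<alpha>"

lemma twisted_simps [simp]: "cscale twisted = cscale V" "gr twisted = gr V"
  by (simp_all add: twisted_complex_def)

lemma twisted_diff_terms_eq:
  assumes "v \<in> gr V d"
  shows "twisted_diff_terms V \<gamma> \<phi> \<alpha> v = tw_terms V \<gamma> \<alpha> \<kappa> [v]"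
  using gamma_zero[of "[d]" "[v]"] assms
  by (auto simp: twisted_diff_terms_def tw_terms_def fun_eq_iff phi_eq_0 not_less_eq_eq)

lemma cdiff_twisted:
  assumes "v \<in> gr V d"
  shows "cdiff twisted v = cdiff V v + action \<kappa> [v]"
  using twisted_diff_terms_eq[OF assms] by (simp add: twisted_complex_def tw_action_def)

lemma action_kappa_linear: "linear_on (cscale V) (cscale V) (gr V d) (\<lambda>v. action \<kappa> [v])"
  using tw_action_slot_linear[OF kappa_family, of "[]" "[]" "[]" "[]"] by simp

lemma action_kappa_closed: "v \<in> gr V d \<Longrightarrow> action \<kappa> [v] \<in> gr V (d + 1)"
  using tw_action_closed[of \<kappa> "[v]" 1 "[d]"] kappa_family by (simp add: add.commute)

text \<open>The Leibniz rule for \<open>\<kappa>\<close>, in which the relation for \<open>\<kappa>\<close> eliminates all terms except iterates of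
  the two summands of \<open>\<partial>\<^sup>\<alpha>\<close>.\<close>

lemma cdiff_action_kappa:
  assumes v: "v \<in> gr V d"
  shows "cdiff V (action \<kappa> [v]) = - action \<kappa> [action \<kappa> [v]] - action \<kappa> [cdiff V v]"
proof -
  have "cdiff V (action \<kappa> [v]) = action (diff_family 1 1 \<kappa>) [v] + action (insert_brackets 1 \<kappa>) [v]
      - action \<kappa> [cdiff V v]"
    using cdiff_tw_action[OF kappa_Tw, of "[d]" "[v]"] v by simp
  then show ?thesis using kappa_relation[OF v] by (simp add: eq_neg_iff_add_eq_0)
qed

lemma cochain_complex_twisted: "cochain_complex twisted"
proof
  show "graded_space (cscale twisted) (gr twisted)" using graded_space_V by simp
  fix d
  show "cdiff twisted v \<in> gr twisted (d + 1)" if "v \<in> gr twisted d" for v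
    using that cdiff_closed[of v d] action_kappa_closed[of v d] vec.subspace_add[OF subspace_gr]
    by (simp add: cdiff_twisted)
  show "linear_on (cscale twisted) (cscale twisted) (gr twisted d) (cdiff twisted)"
    using linear_onD[OF cdiff_linear[of d]] linear_onD[OF action_kappa_linear[of d]]
      vec.subspace_add[OF subspace_gr] vec.subspace_scale[OF subspace_gr]
    by (simp add: linear_on_def cdiff_twisted[of _ d] vec.scale_right_distrib)
  show "cdiff twisted (cdiff twisted v) = 0" if "v \<in> gr twisted d" for v
  proof -
    have v: "v \<in> gr V d" using that by simp
    have dv: "cdiff V v \<in> gr V (d + 1)" and kv: "action \<kappa> [v] \<in> gr V (d + 1)"
      using cdiff_closed[OF v] action_kappa_closed[OF v] .
    have "cdiff twisted (cdiff twisted v) = cdiff V (action \<kappa> [v]) + (action \<kappa> [cdiff V v] + action \<kappa> [action \<kappa> [v]])"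
      using linear_onD(1)[OF cdiff_linear dv kv] linear_onD(1)[OF action_kappa_linear dv kv]
        cdiff_cdiff[OF v] vec.subspace_add[OF subspace_gr dv kv]
      by (simp add: cdiff_twisted[OF v] cdiff_twisted[of _ "d + 1"])
    then show ?thesis unfolding cdiff_action_kappa[OF v] by simp
  qed
qed

text \<open>Inserting \<open>\<kappa>\<close> at the root or at an input of \<open>f\<close> acts by applying the operator
  \<open>v \<mapsto> \<kappa>(v)\<close>, by which \<open>\<partial>\<^sup>\<alpha>\<close> differs from \<open>\<partial>\<close>, to the result or to an argument.\<close>

lemma action_tw_diff:
  assumes f: "f \<in> family n e" and vs: "homogeneous V ds vs" and n: "n = length vs"
  shows "action (tw_diff P \<phi> n e f) vs = action (diff_family n e f) vs
    - cscale V ((-1) powi e) (action (insert_brackets n f) vs)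
    + action \<kappa> [action f vs]
    - cscale V ((-1) powi e) (\<Sum>i<n. cscale V ((-1) powi sum_list (take i ds)) (action f (vs[i := action \<kappa> [vs ! i]])))"
proof -
  let ?s = "(-1) powi e :: 'k"
  let ?S = "\<lambda>c f (r::nat). oscale P c (f r)"
  have len: "length ds = n" using list_all2_lengthD[OF vs] n by simp
  have split_vs: "take i vs @ [vs ! i] @ drop (Suc i) vs = vs" if "i < n" for i
    using that by (simp add: n id_take_nth_drop[symmetric])
  have slot: "homogeneous V (take i ds) (take i vs)" "homogeneous V [ds ! i] [vs ! i]"
    "homogeneous V (drop (Suc i) ds) (drop (Suc i) vs)" if "i < n" for i
    using vs that n by (auto intro: list_all2_takeI list_all2_dropI simp: list_all2_conv_all_nth)
  have ins_f: "tw_ins P n (Suc i) 1 f \<kappa> \<in> family n (e + 1)"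
    "action (tw_ins P n (Suc i) 1 f \<kappa>) vs
      = cscale V ((-1) powi sum_list (take i ds)) (action f (vs[i := action \<kappa> [vs ! i]]))" if i: "i < n" for i
  proof -
    have lens: "n = length (take i vs) + 1 + length (drop (Suc i) vs)" "Suc i = length (take i vs) + 1"
      using i n by auto
    have f': "f \<in> family (length (take i vs) + 1 + length (drop (Suc i) vs)) e" using f lens(1) by metis
    have k': "\<kappa> \<in> family (length [vs ! i]) 1" using kappa_family by simp
    have m: "1 = length [vs ! i]" by simp
    show "tw_ins P n (Suc i) 1 f \<kappa> \<in> family n (e + 1)"
      using tw_ins_eval(2)[OF f' k' slot[OF i] lens(1) m lens(2)] by simp
    show "action (tw_ins P n (Suc i) 1 f \<kappa>) vs
      = cscale V ((-1) powi sum_list (take i ds)) (action f (vs[i := action \<kappa> [vs ! i]]))"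
      using tw_action_ins[OF f' k' slot[OF i] lens(1) m lens(2)] split_vs[OF i] i n
      by (simp add: upd_conv_take_nth_drop)
  qed
  have ins_k: "tw_ins P 1 1 n \<kappa> f \<in> family n (e + 1)" "action (tw_ins P 1 1 n \<kappa> f) vs = action \<kappa> [action f vs]"
    using tw_ins_eval(2)[of \<kappa> "[]" "[]" 1 f vs e "[]" ds "[]" 1 n 1]
      tw_action_ins[of \<kappa> "[]" "[]" 1 f vs e "[]" ds "[]" 1 n 1] kappa_family f vs n
    by (simp_all add: add.commute)
  have a: "diff_family n e f \<in> family n (e + 1)" and b: "insert_brackets n f \<in> family n (e + 1)"
    using diff_family_family[OF f] insert_brackets_family[OF f vs n] .
  have "tw_diff P \<phi> n e f = diff_family n e f - ?S ?s (insert_brackets n f) + tw_ins P 1 1 n \<kappa> f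
      - ?S ?s (\<Sum>i<n. tw_ins P n (Suc i) 1 f \<kappa>)"
    by (simp add: tw_diff_def Let_def fun_eq_iff sum_fun_apply diff_family_def insert_brackets_def
        sum.atLeast1_atMost_eq)
  moreover note lin = tw_action_linear[OF vs n[symmetric], of "e + 1"]
  note sub = subspace_family[of n "e + 1"]
  note closed = module.subspace_add[OF module_families sub] module.subspace_diff[OF module_families sub]
    module.subspace_scale[OF module_families sub] module.subspace_sum[OF module_families sub]
  have c: "(\<Sum>i<n. tw_ins P n (Suc i) 1 f \<kappa>) \<in> family n (e + 1)"
    by (rule closed(4)) (rule ins_f(1), simp)
  have "action (diff_family n e f - ?S ?s (insert_brackets n f) + tw_ins P 1 1 n \<kappa> f
      - ?S ?s (\<Sum>i<n. tw_ins P n (Suc i) 1 f \<kappa>)) vs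
    = action (diff_family n e f) vs - cscale V ?s (action (insert_brackets n f) vs)
      + action (tw_ins P 1 1 n \<kappa> f) vs - cscale V ?s (action (\<Sum>i<n. tw_ins P n (Suc i) 1 f \<kappa>) vs)"
    by (simp only: linear_on_diff[OF lin module_families sub] linear_onD[OF lin] closed a b c ins_k(1))
  moreover have "action (\<Sum>i<n. tw_ins P n (Suc i) 1 f \<kappa>) vs
      = (\<Sum>i<n. cscale V ((-1) powi sum_list (take i ds)) (action f (vs[i := action \<kappa> [vs ! i]])))"
    using linear_on_sum[OF lin module_families sub, of "{..<n}" "\<lambda>i. tw_ins P n (Suc i) 1 f \<kappa>"] ins_f
    by simp
  ultimately show ?thesis using ins_k(2) by simp
qed

theorem operad_algebra_twisted: "operad_algebra (Tw P \<phi>) twisted action"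
proof -
  interpret tw: cochain_complex twisted by (rule cochain_complex_twisted)
  have Tw_simps: "oscale (Tw P \<phi>) = (\<lambda>c f r. oscale P c (f r))" "ins (Tw P \<phi>) = tw_ins P"
    "odiff (Tw P \<phi>) = tw_diff P \<phi>" "unit (Tw P \<phi>) = (\<lambda>r. if r = 0 then unit P else 0)"
    "act (Tw P \<phi>) = (\<lambda>n \<sigma> f r. act P (r + n) (shift_perm r \<sigma>) (f r))"
    by (simp_all add: Tw_def shift_perm_def)
  have fam: "f \<in> family n e" if "f \<in> component (Tw P \<phi>) n e" for f n e
    using that by (simp add: Tw_component_iff)
  show ?thesis
  proof (unfold_locales, unfold twisted_simps Tw_simps)
    fix f n e and vs :: "'v list" and ds
    assume "f \<in> component (Tw P \<phi>) n e" "length vs = n" "homogeneous V ds vs"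
    then show "action f vs \<in> gr V (e + sum_list ds)"
      by (intro tw_action_closed) (auto dest: fam)
  next
    fix vs :: "'v list" and n ds e
    assume "length vs = n" "homogeneous V ds vs"
    then show "linear_on (\<lambda>c f r. oscale P c (f r)) (cscale V) (component (Tw P \<phi>) n e) (\<lambda>f. action f vs)"
      using linear_onD[OF tw_action_linear, of ds vs n _ e] fam unfolding linear_on_def by blast
  next
    fix f n e and us ws :: "'v list" and ds cs b
    assume "f \<in> component (Tw P \<phi>) n e" "length us + 1 + length ws = n" "homogeneous V ds us" "homogeneous V cs ws"
    then show "linear_on (cscale V) (cscale V) (gr V b) (\<lambda>v. action f (us @ v # ws))"
      using tw_action_slot_linear fam by blast
  next
    fix v d assume v: "v \<in> gr V d"
    have "tw_terms V \<gamma> \<alpha> (\<lambda>r. if r = 0 then unit P else 0) [v] = (\<lambda>r. if r = 0 then v else 0)"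
      using v alg_unit[OF v] gamma_zero[OF homogeneous_alphas_append[of "[d]" "[v]"]]
      by (auto simp: tw_terms_def fun_eq_iff)
    then show "action (\<lambda>r. if r = 0 then unit P else 0) [v] = v"
      using series_single[OF v] by (intro tw_action_eqI) simp
  next
    fix f n d g m e and us ws vs :: "'v list" and as bs cs
    assume "f \<in> component (Tw P \<phi>) n d" "g \<in> component (Tw P \<phi>) m e" "length us + 1 + length ws = n"
      "length vs = m" "homogeneous V as us" "homogeneous V bs vs" "homogeneous V cs ws"
    then show "action (tw_ins P n (length us + 1) m f g) (us @ vs @ ws)
        = cscale V ((-1) powi (e * sum_list as)) (action f (us @ action g vs # ws))"
      by (intro tw_action_ins) (auto dest: fam)
  next
    fix f n e \<sigma> and vs :: "'v list" and ds
    assume f: "f \<in> component (Tw P \<phi>) n e" and \<sigma>: "\<sigma> permutes {1..n}" and n: "length vs = n"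
      and vs: "homogeneous V ds vs"
    have len: "length ds = n" using list_all2_lengthD[OF vs] n by simp
    have perm_vs: "homogeneous V (permute \<sigma> ds) (permute \<sigma> vs)"
    proof (unfold list_all2_conv_all_nth, intro conjI allI impI)
      fix i assume "i < length (permute \<sigma> ds)"
      then have i: "i < n" by (simp add: len)
      then have "\<sigma> (Suc i) \<in> {1..n}" unfolding permutes_in_image[OF \<sigma>] by simp
      then have "\<sigma> (Suc i) - 1 < n" by auto
      then show "permute \<sigma> vs ! i \<in> gr V (permute \<sigma> ds ! i)"
        using vs i len n by (simp add: nth_permute list_all2_conv_all_nth)
    qed (simp add: len n)
    have "tw_terms V \<gamma> \<alpha> (\<lambda>r. act P (r + n) (shift_perm r \<sigma>) (f r)) vs
        = (\<lambda>r. cscale V (koszul_sign \<sigma> ds) (tw_terms V \<gamma> \<alpha> f (permute \<sigma> vs) r))"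
    proof
      fix r
      have "(koszul_sign (shift_perm r \<sigma>) (replicate r 2 @ ds) :: 'k) = koszul_sign \<sigma> ds"
        by (rule koszul_sign_shift_perm[of \<sigma> ds "replicate r 2", unfolded length_replicate])
          (simp only: len \<sigma>)
      then have "\<gamma> (act P (r + n) (shift_perm r \<sigma>) (f r)) (replicate r \<alpha> @ vs)
          = cscale V (koszul_sign \<sigma> ds) (\<gamma> (f r) (replicate r \<alpha> @ permute \<sigma> vs))"
        using alg_act[OF familyD[OF fam[OF f]] shift_perm_permutes[OF \<sigma>] _ homogeneous_alphas_append[OF vs], of r]
          permute_shift_perm[of \<sigma> vs "replicate r \<alpha>"] \<sigma> n len
        by simp
      then show "tw_terms V \<gamma> \<alpha> (\<lambda>r. act P (r + n) (shift_perm r \<sigma>) (f r)) vs r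
          = cscale V (koszul_sign \<sigma> ds) (tw_terms V \<gamma> \<alpha> f (permute \<sigma> vs) r)"
        by (simp add: tw_terms_def mult.commute)
    qed
    moreover have "series (e + sum_list (permute \<sigma> ds)) (tw_terms V \<gamma> \<alpha> f (permute \<sigma> vs)) (action f (permute \<sigma> vs))"
      using fam[OF f] n by (intro tw_action_series perm_vs) simp
    ultimately show "action (\<lambda>r. act P (r + n) (shift_perm r \<sigma>) (f r)) vs
        = cscale V (koszul_sign \<sigma> ds) (action f (permute \<sigma> vs))"
      using series_scale by (intro tw_action_eqI) simp
  next
    fix f n e and vs :: "'v list" and ds
    assume f: "f \<in> component (Tw P \<phi>) n e" and n: "length vs = n" and vs: "homogeneous V ds vs"
    let ?s = "\<lambda>i. (-1) powi sum_list (take i ds) :: 'k"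
    have "action f (vs[i := cdiff twisted (vs ! i)])
        = action f (vs[i := cdiff V (vs ! i)]) + action f (vs[i := action \<kappa> [vs ! i]])" if i: "i < n" for i
    proof -
      have vi: "vs ! i \<in> gr V (ds ! i)" using vs i n by (simp add: list_all2_conv_all_nth)
      have "linear_on (cscale V) (cscale V) (gr V (ds ! i + 1)) (\<lambda>v. action f (take i vs @ v # drop (Suc i) vs))"
        using i n by (intro tw_action_slot_linear[OF fam[OF f] _ list_all2_takeI[OF vs] list_all2_dropI[OF vs]]) simp
      from linear_onD(1)[OF this cdiff_closed[OF vi] action_kappa_closed[OF vi]] show ?thesis
        using i n by (simp add: upd_conv_take_nth_drop cdiff_twisted[OF vi])
    qed
    then have "(\<Sum>i<n. cscale V (?s i) (action f (vs[i := cdiff twisted (vs ! i)])))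
        = (\<Sum>i<n. cscale V (?s i) (action f (vs[i := cdiff V (vs ! i)])))
          + (\<Sum>i<n. cscale V (?s i) (action f (vs[i := action \<kappa> [vs ! i]])))"
      by (simp add: vec.scale_right_distrib sum.distrib)
    moreover have "cdiff twisted (action f vs) = cdiff V (action f vs) + action \<kappa> [action f vs]"
      using tw_action_closed[OF _ vs] fam[OF f] n by (intro cdiff_twisted) auto
    ultimately show "cdiff twisted (action f vs) = action (tw_diff P \<phi> n e f) vs
        + cscale V ((-1) powi e) (\<Sum>i<n. cscale V (?s i) (action f (vs[i := cdiff twisted (vs ! i)])))"
      unfolding action_tw_diff[OF fam[OF f] vs n[symmetric]] cdiff_tw_action[OF f vs n[symmetric]]
      by (simp add: vec.scale_right_distrib vec.scale_right_diff_distrib)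
  qed
qed

end

section \<open>The brackets of a morphism from the operad of homotopy Lie algebras\<close>

context Lambda_Lie_infinity
begin

lemma lam_closed: "2 \<le> n \<Longrightarrow> lam n \<in> component L n (3 - 2 * int n)"
  and lam_invariant: "2 \<le> n \<Longrightarrow> \<sigma> permutes {1..n} \<Longrightarrow> act L n \<sigma> (lam n) = lam n"
  using free by (simp_all add: free_graded_operad_def invariant_family_def)

lemma generator_images_brackets:
  assumes P: "dg_operad P" and \<Phi>: "dg_operad_morphism L P \<Phi>"
  defines "\<phi> \<equiv> generator_images \<Phi> lam"
  shows "\<phi> n \<in> component P n (3 - 2 * int n)"
    and "\<sigma> permutes {1..n} \<Longrightarrow> act P n \<sigma> (\<phi> n) = \<phi> n"
    and "n < 2 \<Longrightarrow> \<phi> n = 0"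
    and "odiff P n (3 - 2 * int n) (\<phi> n) =
      - (\<Sum>p = 2..n - 1. \<Sum>\<sigma>\<in>Sh p (n - p).
          act P n \<sigma> (ins P (n - p + 1) 1 p (\<phi> (n - p + 1)) (\<phi> p)))"
proof -
  interpret P: dg_operad P by (rule P)
  have mod: "module (oscale L)" "module (oscale P)"
    using graded_spaceD(2)[OF graded] graded_spaceD(2)[OF P.graded] .
  have subL: "module.subspace (oscale L) (component L n d)" for n d
    using graded_spaceD(3)[OF graded] .
  have subP: "module.subspace (oscale P) (component P n d)" for n d
    using graded_spaceD(3)[OF P.graded] .
  have mor: "\<Phi> n ` component L n d \<subseteq> component P n d"
    "linear_on (oscale L) (oscale P) (component L n d) (\<Phi> n)"
    "f \<in> component L n d \<Longrightarrow> \<sigma> permutes {1..n} \<Longrightarrow> \<Phi> n (act L n \<sigma> f) = act P n \<sigma> (\<Phi> n f)"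
    "f \<in> component L n d \<Longrightarrow> g \<in> component L m e \<Longrightarrow> i \<in> {1..n} \<Longrightarrow>
      \<Phi> (n + m - 1) (ins L n i m f g) = ins P n i m (\<Phi> n f) (\<Phi> m g)"
    "f \<in> component L n d \<Longrightarrow> \<Phi> n (odiff L n d f) = odiff P n d (\<Phi> n f)" for n m d e i \<sigma> f g
    using \<Phi> by (simp_all add: dg_operad_morphism_def operad_morphism_def)
  have \<phi>: "\<phi> n = \<Phi> n (lam n)" if "2 \<le> n" for n using that by (simp add: \<phi>_def generator_images_def)
  show \<phi>_0: "\<phi> n = 0" if "n < 2" for n using that by (simp add: \<phi>_def generator_images_def)
  show "\<phi> n \<in> component P n (3 - 2 * int n)"
    using \<phi> \<phi>_0 subsetD[OF mor(1) imageI[OF lam_closed]] module.subspace_0[OF mod(2) subP]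
    by (cases "2 \<le> n") auto
  show "act P n \<sigma> (\<phi> n) = \<phi> n" if "\<sigma> permutes {1..n}"
  proof (cases "2 \<le> n")
    case True
    then show ?thesis using mor(3)[OF lam_closed[OF True] that] \<phi> lam_invariant[OF True that] by simp
  next
    case False
    then show ?thesis
      using linear_on_zero[OF P.act_linear[OF that, where d = 0] mod(2) subP] \<phi>_0 by simp
  qed
  show "odiff P n (3 - 2 * int n) (\<phi> n) =
      - (\<Sum>p = 2..n - 1. \<Sum>\<sigma>\<in>Sh p (n - p).
          act P n \<sigma> (ins P (n - p + 1) 1 p (\<phi> (n - p + 1)) (\<phi> p)))"
  proof (cases "2 \<le> n")
    case False
    then show ?thesis
      using linear_on_zero[OF P.odiff_linear[of n "3 - 2 * int n"] mod(2) subP] \<phi>_0 by simp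
  next
    case True
    let ?i = "\<lambda>p. ins L (n - p + 1) 1 p (lam (n - p + 1)) (lam p)"
    have ins: "?i p \<in> component L n (4 - 2 * int n)"
      "\<Phi> n (?i p) = ins P (n - p + 1) 1 p (\<phi> (n - p + 1)) (\<phi> p)" if "p \<in> {2..n - 1}" for p
    proof -
      have p: "2 \<le> p" "2 \<le> n - p + 1" using that by auto
      have ar: "n - p + 1 + p - 1 = n" "1 \<in> {1..n - p + 1}" using that by auto
      have "p \<le> n" using that by auto
      then have deg: "3 - 2 * int (n - p + 1) + (3 - 2 * int p) = 4 - 2 * int n"
        by (simp add: of_nat_diff)
      show "?i p \<in> component L n (4 - 2 * int n)"
        using ins_closed[OF ar(2) lam_closed[OF p(2)] lam_closed[OF p(1)]] unfolding deg ar(1) .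
      show "\<Phi> n (?i p) = ins P (n - p + 1) 1 p (\<phi> (n - p + 1)) (\<phi> p)"
        using mor(4)[OF lam_closed[OF p(2)] lam_closed[OF p(1)] ar(2)] unfolding ar(1) \<phi>[OF p(1)] \<phi>[OF p(2)] .
    qed
    have perm: "\<sigma> permutes {1..n}" if "\<sigma> \<in> Sh p (n - p)" "p \<in> {2..n - 1}" for \<sigma> p
      using that by (auto simp: Sh_def)
    have act: "act L n \<sigma> (?i p) \<in> component L n (4 - 2 * int n)"
      "\<Phi> n (act L n \<sigma> (?i p)) = act P n \<sigma> (ins P (n - p + 1) 1 p (\<phi> (n - p + 1)) (\<phi> p))"
      if "p \<in> {2..n - 1}" "\<sigma> \<in> Sh p (n - p)" for p \<sigma>
      using act_closed[OF perm[OF that(2,1)] ins(1)[OF that(1)]] mor(3)[OF ins(1)[OF that(1)] perm[OF that(2,1)]]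
        ins(2)[OF that(1)] by simp_all
    note lin = mor(2)[of n "4 - 2 * int n"]
    have inner: "(\<Sum>\<sigma>\<in>Sh p (n - p). act L n \<sigma> (?i p)) \<in> component L n (4 - 2 * int n)"
      if "p \<in> {2..n - 1}" for p
      by (rule module.subspace_sum[OF mod(1) subL]) (rule act(1)[OF that])
    have "odiff P n (3 - 2 * int n) (\<phi> n) = \<Phi> n (- (\<Sum>p = 2..n - 1. \<Sum>\<sigma>\<in>Sh p (n - p). act L n \<sigma> (?i p)))"
      using mor(5)[OF lam_closed[OF True]] odiff_lam[OF True] \<phi>[OF True] by simp
    also have "\<dots> = - (\<Sum>p = 2..n - 1. \<Phi> n (\<Sum>\<sigma>\<in>Sh p (n - p). act L n \<sigma> (?i p)))"
      by (simp only: linear_on_neg[OF lin mod(1) subL module.subspace_sum[OF mod(1) subL inner]]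
          linear_on_sum[OF lin mod(1) subL inner])
    also have "(\<Sum>p = 2..n - 1. \<Phi> n (\<Sum>\<sigma>\<in>Sh p (n - p). act L n \<sigma> (?i p)))
        = (\<Sum>p = 2..n - 1. \<Sum>\<sigma>\<in>Sh p (n - p). \<Phi> n (act L n \<sigma> (?i p)))"
      by (intro sum.cong refl linear_on_sum[OF lin mod(1) subL] act(1))
    also have "\<dots> = (\<Sum>p = 2..n - 1. \<Sum>\<sigma>\<in>Sh p (n - p).
        act P n \<sigma> (ins P (n - p + 1) 1 p (\<phi> (n - p + 1)) (\<phi> p)))"
      by (intro sum.cong refl act(2))
    finally show ?thesis .
  qed
qed

end

lemma (in filtered_algebra) maurer_cartan_imp_series:
  assumes mc: "maurer_cartan V \<gamma> \<phi> F \<alpha>"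
    and \<phi>: "\<And>n. \<phi> n \<in> component P n (3 - 2 * int n)" "\<And>n. n < 2 \<Longrightarrow> \<phi> n = 0"
  shows "series 3 (\<lambda>n. cscale V (1 / fact n) (\<gamma> (\<phi> n) (replicate n \<alpha>))) (- cdiff V \<alpha>)"
proof -
  let ?x = "\<lambda>n. cscale V (1 / fact n) (\<gamma> (\<phi> n) (replicate n \<alpha>))"
  have "?x n \<in> F n 3" for n
    using gamma_F_alphas[of "\<phi> n" n "[]" "3 - 2 * int n" "[]"] \<phi>(1)[of n] by (intro F_scale) simp
  then have "series 3 ?x (filt_suminf F ?x)" by (rule series_filt_suminf)
  moreover have "(\<lambda>n. if 2 \<le> n then ?x n else 0) = ?x"
    using \<phi>(2) gamma_zero[OF homogeneous_alphas] by (auto simp: fun_eq_iff)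
  then have "filt_suminf F ?x = - cdiff V \<alpha>"
    using mc by (simp add: maurer_cartan_def eq_neg_iff_add_eq_0 add.commute)
  ultimately show ?thesis by simp
qed

theorem theorem3p8:
  fixes L :: "('k::field_char_0, 'l::ab_group_add) dg_operad_struct"
    and lam :: "nat \<Rightarrow> 'l"
    and P :: "('k, 'a::ab_group_add) dg_operad_struct"
    and \<Phi> :: "nat \<Rightarrow> 'l \<Rightarrow> 'a"
    and V :: "('k, 'v::ab_group_add) complex_struct"
    and \<gamma> :: "'a \<Rightarrow> 'v list \<Rightarrow> 'v"
    and F :: "nat \<Rightarrow> int \<Rightarrow> 'v set"
    and \<alpha> :: 'v
  assumes "Lambda_Lie_infinity L lam"
    and "dg_operad P"
    and "dg_operad_morphism L P \<Phi>"
    and "operad_algebra P V \<gamma>"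
    and "complete_filtration V F"
    and "compatible_filtration P V \<gamma> F"
    and "maurer_cartan V \<gamma> (generator_images \<Phi> lam) F \<alpha>"
  shows "(\<forall>d. \<forall>v\<in>gr V d.
            filt_sums F (twisted_diff_terms V \<gamma> (generator_images \<Phi> lam) \<alpha> v)
              (filt_suminf F (twisted_diff_terms V \<gamma> (generator_images \<Phi> lam) \<alpha> v))) \<and>
         (\<forall>n e f ds vs. f \<in> component (Tw P (generator_images \<Phi> lam)) n e \<and> length vs = n \<and>
            homogeneous V ds vs \<longrightarrow>
            filt_sums F (tw_terms V \<gamma> \<alpha> f vs) (tw_action V \<gamma> F \<alpha> f vs)) \<and>
         operad_algebra (Tw P (generator_images \<Phi> lam))
           (twisted_complex V \<gamma> (generator_images \<Phi> lam) F \<alpha>)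
           (tw_action V \<gamma> F \<alpha>)"
proof -
  interpret Lambda_Lie_infinity L lam by fact
  note brackets = generator_images_brackets[OF assms(2,3)]
  interpret P: dg_operad P by fact
  interpret A: operad_algebra P V \<gamma> by fact
  interpret filtered_algebra P V \<gamma> F \<alpha>
    using assms(5-7) A.graded_V by unfold_locales (auto simp: maurer_cartan_def)
  interpret twisting P V \<gamma> F \<alpha> "generator_images \<Phi> lam"
    using brackets maurer_cartan_imp_series[OF assms(7) brackets(1,3)] by unfold_locales auto
  have sums: "filt_sums F (tw_terms V \<gamma> \<alpha> f vs) (tw_action V \<gamma> F \<alpha> f vs)"
    if "f \<in> family (length vs) e" "homogeneous V ds vs" for f e ds vs
    using series_imp_filt_sums[OF tw_action_series[OF that]] .
  show ?thesis
  proof (intro conjI allI impI ballI)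
    fix d v assume v: "v \<in> gr V d"
    then show "filt_sums F (twisted_diff_terms V \<gamma> (generator_images \<Phi> lam) \<alpha> v)
        (filt_suminf F (twisted_diff_terms V \<gamma> (generator_images \<Phi> lam) \<alpha> v))"
      using sums[of \<kappa> "[v]" 1 "[d]"] kappa_family by (simp add: twisted_diff_terms_eq[OF v] tw_action_def)
  next
    fix n e f ds vs
    assume "f \<in> component (Tw P (generator_images \<Phi> lam)) n e \<and> length vs = n \<and> homogeneous V ds vs"
    then show "filt_sums F (tw_terms V \<gamma> \<alpha> f vs) (tw_action V \<gamma> F \<alpha> f vs)"
      by (auto simp: Tw_component_iff intro: sums)
  next
    show "operad_algebra (Tw P (generator_images \<Phi> lam))
        (twisted_complex V \<gamma> (generator_images \<Phi> lam) F \<alpha>) (tw_action V \<gamma> F \<alpha>)"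
      by (rule operad_algebra_twisted)
  qed
qed

end
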